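(* For support size estimation, i.e., estimating $|\{i: p_i>0\}|$ to within additive error $\varepsilon d$ for an unknown distribution $P=(p_1,\dots)$ whose nonzero probabilities are all at least $1/d$, the quantum query complexity (in the purified quantum query access model) is $\Omega\!\left(\frac{\sqrt{d}}{\sqrt{\log d}}\log\frac{1}{\varepsilon}\right)$.
   Context: Purified quantum query access to a distribution $P=(p_1,\dots,p_n)$: a unitary $U$ on two registers $\mathsf{A},\mathsf{B}$ with $U\ket{0}_{\mathsf A}\ket{0}_{\mathsf B}=\sum_{i}\sqrt{p_i}\ket{i}_{\mathsf A}\ket{\psi_i}_{\mathsf B}$ for some orthonormal set $\{\ket{\psi_i}\}$; one query means one application of $U$, $U^\dagger$, controlled-$U$ or controlled-$U^\dagger$. The query complexity is the minimum number of queries of a quantum algorithm that outputs an $\varepsilon d$-accurate estimate with probability at least $2/3$ for every valid input distribution.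
   Formalization: The bound is stated for all large d and for 1/d ≤ ε ≤ ε0 with a small constant ε0; it fails for fixed d as ε tends to 0, since exact counting needs finitely many queries, and for ε ≥ 1/2, where no query is needed. *)

theory Defs
  imports Complex_Main "Jordan_Normal_Form.Matrix"
begin

definition adj :: "complex mat \<Rightarrow> complex mat" where
  "adj U = mat (dim_col U) (dim_row U) (\<lambda>(i,j). cnj (U $$ (j,i)))"

definition is_unitary :: "nat \<Rightarrow> complex mat \<Rightarrow> bool" where
  "is_unitary N U \<longleftrightarrow> U \<in> carrier_mat N N \<and> U * adj U = 1\<^sub>m N \<and> adj U * U = 1\<^sub>m N"

definition cinner :: "complex vec \<Rightarrow> complex vec \<Rightarrow> complex" where
  "cinner u v = (\<Sum>i<dim_vec u. cnj (u $ i) * v $ i)"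

definition valid_dist :: "real \<Rightarrow> nat \<Rightarrow> (nat \<Rightarrow> real) \<Rightarrow> bool" where
  "valid_dist d n p \<longleftrightarrow> (\<forall>i<n. 0 \<le> p i) \<and> (\<Sum>i<n. p i) = 1 \<and> (\<forall>i<n. p i > 0 \<longrightarrow> p i \<ge> 1 / d)"

definition support_size :: "nat \<Rightarrow> (nat \<Rightarrow> real) \<Rightarrow> nat" where
  "support_size n p = card {i. i < n \<and> p i > 0}"

text \<open>Registers A (dimension n) and B (dimension m); basis state \<open>|a\<rangle>|b\<rangle>\<close> has index \<open>a*m+b\<close>.
  U is a unitary on A\<otimes>B with \<open>U|0\<rangle>|0\<rangle> = \<Sum>i sqrt(p_i)|i\<rangle>|\<psi>_i\<rangle>\<close>, \<open>\<psi>_i\<close> orthonormal in \<open>\<complex>^m\<close>.\<close>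
definition purified_oracle :: "nat \<Rightarrow> nat \<Rightarrow> (nat \<Rightarrow> real) \<Rightarrow> complex mat \<Rightarrow> bool" where
  "purified_oracle n m p U \<longleftrightarrow> is_unitary (n*m) U \<and>
     (\<exists>\<psi> :: nat \<Rightarrow> complex vec.
        (\<forall>i<n. dim_vec (\<psi> i) = m) \<and>
        (\<forall>i<n. \<forall>j<n. cinner (\<psi> i) (\<psi> j) = (if i = j then 1 else 0)) \<and>
        (\<forall>i<n. \<forall>b<m. U $$ (i*m + b, 0) = complex_of_real (sqrt (p i)) * \<psi> i $ b))"

text \<open>The full space is A\<otimes>B\<otimes>W, W a workspace register of dimension k; basis index
  \<open>x*k + w\<close> with x the index in A\<otimes>B. The low bit of w (\<open>w mod 2\<close>) serves as control qubit.\<close>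

definition lift_op :: "nat \<Rightarrow> complex mat \<Rightarrow> complex mat" where
  "lift_op k U = mat (dim_row U * k) (dim_col U * k)
     (\<lambda>(r,c). if r mod k = c mod k then U $$ (r div k, c div k) else 0)"

definition ctrl_op :: "nat \<Rightarrow> complex mat \<Rightarrow> complex mat" where
  "ctrl_op k U = mat (dim_row U * k) (dim_col U * k)
     (\<lambda>(r,c). if r mod k \<noteq> c mod k then 0
              else if odd (r mod k) then U $$ (r div k, c div k)
              else if r div k = c div k then 1 else 0)"

datatype qtype = QU | QUadj | QcU | QcUadj

fun query_op :: "nat \<Rightarrow> qtype \<Rightarrow> complex mat \<Rightarrow> complex mat" where
  "query_op k QU U = lift_op k U"
| "query_op k QUadj U = lift_op k (adj U)"
| "query_op k QcU U = ctrl_op k U"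
| "query_op k QcUadj U = ctrl_op k (adj U)"

text \<open>An algorithm with T queries: workspace dimension k, input-independent unitaries
  \<open>V 0, ..., V T\<close> on the full space, query types \<open>q 0, ..., q (T-1)\<close>, and a classical
  post-processing map \<open>out\<close> from computational-basis measurement outcomes to estimates.\<close>
record qalg =
  nqueries :: nat
  wdim :: nat
  gates :: "nat \<Rightarrow> complex mat"
  qtypes :: "nat \<Rightarrow> qtype"
  outmap :: "nat \<Rightarrow> real"

definition well_formed_alg :: "nat \<Rightarrow> nat \<Rightarrow> qalg \<Rightarrow> bool" where
  "well_formed_alg n m A \<longleftrightarrow> wdim A \<ge> 2 \<and>
     (\<forall>t\<le>nqueries A. is_unitary (n*m*wdim A) (gates A t))"

fun run_state :: "nat \<Rightarrow> nat \<Rightarrow> qalg \<Rightarrow> complex mat \<Rightarrow> nat \<Rightarrow> complex vec" where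
  "run_state n m A U 0 = gates A 0 *\<^sub>v unit_vec (n*m*wdim A) 0"
| "run_state n m A U (Suc t) =
     gates A (Suc t) *\<^sub>v (query_op (wdim A) (qtypes A t) U *\<^sub>v run_state n m A U t)"

definition final_state :: "nat \<Rightarrow> nat \<Rightarrow> qalg \<Rightarrow> complex mat \<Rightarrow> complex vec" where
  "final_state n m A U = run_state n m A U (nqueries A)"

definition prob_output :: "nat \<Rightarrow> nat \<Rightarrow> qalg \<Rightarrow> complex mat \<Rightarrow> (real \<Rightarrow> bool) \<Rightarrow> real" where
  "prob_output n m A U S =
     (\<Sum>j | j < n*m*wdim A \<and> S (outmap A j). (cmod (final_state n m A U $ j))\<^sup>2)"

definition solves_support_est :: "real \<Rightarrow> real \<Rightarrow> nat \<Rightarrow> nat \<Rightarrow> qalg \<Rightarrow> bool" where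
  "solves_support_est d \<epsilon> n m A \<longleftrightarrow> well_formed_alg n m A \<and>
     (\<forall>p U. valid_dist d n p \<longrightarrow> purified_oracle n m p U \<longrightarrow>
        prob_output n m A U (\<lambda>x. \<bar>x - real (support_size n p)\<bar> \<le> \<epsilon> * d) \<ge> 2/3)"

end

theory Submission
  imports Defs "HOL-Real_Asymp.Real_Asymp"
begin

text \<open>
  Let the oracle be the reflection that exchanges \<open>|0\<rangle>|0\<rangle>\<close> with a purification of \<open>P\<close> with real
  amplitudes. Rotating the amplitudes of two outcomes into each other by an angle \<open>\<theta>\<close> makes the
  acceptance probability of a \<open>T\<close>-query algorithm a trigonometric polynomial of degree \<open>4T\<close> in \<open>\<theta>\<close>
  with values in \<open>[0, 1]\<close>. Averaged over signs it is a power series in \<open>sin\<^sup>2 \<theta>\<close>, that is, in the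
  probability of one of the outcomes, with coefficients small enough that only the first
  \<open>O(log d)\<close> of them matter for probabilities up to \<open>polylog(d)/d\<close> unless
  \<open>T\<close> is of order \<open>\<surd>d log(1/\<epsilon>)\<close>.

  Draw about \<open>d/(8\<kappa>)\<close> of the probabilities independently from one of two priors on
  \<open>{0} \<union> [1/d, polylog(d)/d]\<close> with mean \<open>\<kappa>/d\<close> whose first \<open>O(log d)\<close> moments agree; a large outcome 0
  absorbs the rest of the mass. Exchanging the priors one coordinate at a time changes the acceptance probability
  by \<open>o(1)\<close>. The masses at 0 of the priors, however, can be made to differ by about \<open>\<kappa> \<surd>\<epsilon> log(1/\<epsilon>)\<close>,
  so the support sizes differ by more than \<open>2 \<epsilon> d\<close>, and an accurate estimate tells the priors apart.
  This gives \<open>T = \<Omega>(\<surd>d log(1/\<epsilon>))\<close>, even without the factor \<open>1/\<surd>(log d)\<close>.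
\<close>

section \<open>Trigonometric polynomials\<close>

text \<open>The degree \<open>K\<close> is only an upper bound. Values are complex so that
  amplitudes are covered; real functions enter through \<open>of_real\<close>.\<close>

definition trig_poly :: "nat \<Rightarrow> (real \<Rightarrow> complex) \<Rightarrow> bool" where
  "trig_poly K f \<longleftrightarrow>
     (\<exists>c. \<forall>\<theta>. f \<theta> = (\<Sum>k\<in>{- int K..int K}. c k * cis (of_int k * \<theta>)))"

lemma trig_polyI:
  assumes "A \<subseteq> {- int K..int K}" "\<And>\<theta>. f \<theta> = (\<Sum>k\<in>A. c k * cis (of_int k * \<theta>))"
  shows "trig_poly K f"
proof -
  have "f \<theta> = (\<Sum>k\<in>{- int K..int K}. (if k \<in> A then c k else 0) * cis (of_int k * \<theta>))" for \<theta>
    unfolding assms(2) by (rule sum.mono_neutral_cong_left) (use assms(1) in auto)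
  then show ?thesis
    unfolding trig_poly_def by (intro exI[of _ "\<lambda>k. if k \<in> A then c k else 0"]) blast
qed

lemma trig_poly_const: "trig_poly K (\<lambda>_. a)"
  by (rule trig_polyI[of "{0}" K _ "\<lambda>_. a"]) auto

lemma trig_poly_add:
  assumes "trig_poly K f" "trig_poly K g"
  shows "trig_poly K (\<lambda>\<theta>. f \<theta> + g \<theta>)"
proof -
  obtain c c' where
    "\<And>\<theta>. f \<theta> = (\<Sum>k\<in>{- int K..int K}. c k * cis (of_int k * \<theta>))"
    "\<And>\<theta>. g \<theta> = (\<Sum>k\<in>{- int K..int K}. c' k * cis (of_int k * \<theta>))"
    using assms unfolding trig_poly_def by blast
  then show ?thesis
    by (intro trig_polyI[of "{- int K..int K}" K _ "\<lambda>k. c k + c' k"])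
       (auto simp: sum.distrib algebra_simps)
qed

lemma trig_poly_sum:
  assumes "\<And>i. i \<in> I \<Longrightarrow> trig_poly K (f i)"
  shows "trig_poly K (\<lambda>\<theta>. \<Sum>i\<in>I. f i \<theta>)"
  using assms
  by (induction I rule: infinite_finite_induct) (auto intro: trig_poly_const trig_poly_add)

lemma trig_poly_shift:
  assumes "trig_poly L g" "\<bar>k\<bar> \<le> int K"
  shows "trig_poly (K + L) (\<lambda>\<theta>. a * cis (of_int k * \<theta>) * g \<theta>)"
proof -
  obtain c where c: "\<And>\<theta>. g \<theta> = (\<Sum>l\<in>{- int L..int L}. c l * cis (of_int l * \<theta>))"
    using assms(1) unfolding trig_poly_def by blast
  have "a * cis (of_int k * \<theta>) * g \<theta> =
      (\<Sum>q\<in>(\<lambda>l. k + l) ` {- int L..int L}. a * c (q - k) * cis (of_int q * \<theta>))" for \<theta>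
    by (subst sum.reindex)
       (auto simp: c sum_distrib_left inj_on_def algebra_simps cis_mult intro!: sum.cong)
  then show ?thesis
    by (intro trig_polyI[of "(\<lambda>l. k + l) ` {- int L..int L}"]) (use assms(2) in auto)
qed

lemma trig_poly_mult:
  assumes "trig_poly K f" "trig_poly L g"
  shows "trig_poly (K + L) (\<lambda>\<theta>. f \<theta> * g \<theta>)"
proof -
  obtain c where c: "\<And>\<theta>. f \<theta> = (\<Sum>k\<in>{- int K..int K}. c k * cis (of_int k * \<theta>))"
    using assms(1) unfolding trig_poly_def by blast
  have "trig_poly (K + L) (\<lambda>\<theta>. \<Sum>k\<in>{- int K..int K}. c k * cis (of_int k * \<theta>) * g \<theta>)"
    by (intro trig_poly_sum trig_poly_shift assms(2)) auto
  then show ?thesis by (simp add: c sum_distrib_right)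
qed

lemma trig_poly_power:
  assumes "trig_poly K f"
  shows "trig_poly (q * K) (\<lambda>\<theta>. f \<theta> ^ q)"
  by (induction q) (auto intro: trig_poly_const trig_poly_mult[OF assms])

lemma trig_poly_cis:
  assumes "\<bar>k\<bar> \<le> int K"
  shows "trig_poly K (\<lambda>\<theta>. cis (of_int k * \<theta>))"
  using trig_poly_shift[OF trig_poly_const[of 0 1] assms, of 1] by simp

lemma trig_poly_cnj:
  assumes "trig_poly K f"
  shows "trig_poly K (\<lambda>\<theta>. cnj (f \<theta>))"
proof -
  obtain c where c: "\<And>\<theta>. f \<theta> = (\<Sum>k\<in>{- int K..int K}. c k * cis (of_int k * \<theta>))"
    using assms(1) unfolding trig_poly_def by blast
  \<comment> \<open>Conjugation negates the frequencies, whose range is symmetric. Constants enter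
    as factors of degree 0, here and below.\<close>
  have "trig_poly K (\<lambda>\<theta>. \<Sum>k\<in>{- int K..int K}. cnj (c k) * cis (of_int (-k) * \<theta>))"
    by (intro trig_poly_sum trig_poly_mult[where K=0, simplified] trig_poly_const trig_poly_cis)
       auto
  then show ?thesis by (simp add: c cis_cnj)
qed

lemma trig_poly_cos: "trig_poly 1 (\<lambda>\<theta>. complex_of_real (a * cos \<theta>))"
proof -
  have "trig_poly 1 (\<lambda>\<theta>. of_real a / 2 * (cis (of_int 1 * \<theta>) + cis (of_int (-1) * \<theta>)))"
    by (intro trig_poly_mult[where K=0, simplified] trig_poly_add trig_poly_const trig_poly_cis) auto
  then show ?thesis by (simp add: complex_eq_iff cis.code Complex_eq algebra_simps)
qed

lemma trig_poly_sin: "trig_poly 1 (\<lambda>\<theta>. complex_of_real (a * sin \<theta>))"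
proof -
  have "trig_poly 1 (\<lambda>\<theta>. of_real a / (2 * \<i>) * (cis (of_int 1 * \<theta>) + (-1) * cis (of_int (-1) * \<theta>)))"
    by (intro trig_poly_mult[where K=0, simplified] trig_poly_add trig_poly_const trig_poly_cis) auto
  moreover have "of_real a / (2 * \<i>) * (cis (of_int 1 * \<theta>) + (-1) * cis (of_int (-1) * \<theta>))
     = complex_of_real (a * sin \<theta>)" for \<theta>
    by (simp add: complex_eq_iff Re_divide Im_divide power2_eq_square)
  ultimately show ?thesis by simp
qed

section \<open>Roots of unity and Fourier coefficients\<close>

lemma sum_roots_of_unity:
  fixes q :: int
  assumes "M > 0"
  shows "(\<Sum>j<M. cis (of_int q * (2 * pi * real j / real M))) = (if int M dvd q then of_nat M else 0)"
proof -
  \<comment> \<open>The sum is geometric with ratio \<open>z\<close>, an \<open>M\<close>-th root of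
    unity that equals 1 exactly when \<open>M\<close> divides \<open>q\<close>.\<close>
  define z where "z = cis (2 * pi * of_int q / real M)"
  have z: "cis (of_int q * (2 * pi * real j / real M)) = z ^ j" for j
    by (simp add: z_def DeMoivre algebra_simps)
  have zM: "z ^ M = 1"
  proof -
    have "z ^ M = cis (2 * pi * of_int q)" using assms by (simp add: z_def DeMoivre)
    also have "\<dots> = 1" by (rule cis_multiple_2pi) auto
    finally show ?thesis .
  qed
  show ?thesis
  proof (cases "int M dvd q")
    case True
    then obtain p where "q = int M * p" by auto
    then have "2 * pi * of_int q / real M = 2 * pi * of_int p" using assms by simp
    then have "z = 1" unfolding z_def by (metis cis_multiple_2pi Ints_of_int)
    then show ?thesis unfolding z using True by simp
  next
    case False
    have "z \<noteq> 1"
    proof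
      assume "z = 1"
      then have "cos (2 * pi * of_int q / real M) = 1" by (auto simp: z_def complex_eq_iff)
      then obtain p :: int where "2 * pi * of_int q / real M = of_int p * 2 * pi"
        using cos_one_2pi_int by blast
      then have "real_of_int q = of_int p * real M" using assms by (simp add: field_simps)
      then have "q = p * int M" by (metis of_int_eq_iff of_int_mult of_int_of_nat_eq)
      with False show False by simp
    qed
    then show ?thesis unfolding z using False by (simp add: geometric_sum zM)
  qed
qed

text \<open>A Fourier coefficient is an average of \<open>F\<close> against a character of modulus
  1. Equispaced sampling at \<open>2 * K + 1\<close> points computes it exactly, because no two
  frequencies between \<open>-K\<close> and \<open>K\<close> are congruent modulo
  \<open>2 * K + 1\<close>.\<close>

lemma trig_poly_coeff_bound:
  assumes F: "\<And>\<theta>. F \<theta> = (\<Sum>k\<in>{- int K..int K}. c k * cis (of_int k * \<theta>))"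
    and bound: "\<And>\<theta>. cmod (F \<theta>) \<le> 1" and k: "\<bar>k\<bar> \<le> int K"
  shows "cmod (c k) \<le> 1"
proof -
  define M where "M = 2 * K + 1"
  define t where "t j = 2 * pi * real j / real M" for j
  have M: "M > 0" by (simp add: M_def)
  have "(\<Sum>j<M. F (t j) * cis (of_int (- k) * t j))
      = (\<Sum>j<M. \<Sum>l\<in>{- int K..int K}. c l * cis (of_int (l - k) * t j))"
    unfolding F sum_distrib_right
    by (intro sum.cong refl) (simp add: mult.assoc cis_mult left_diff_distrib)
  also have "\<dots> = (\<Sum>l\<in>{- int K..int K}. c l * (\<Sum>j<M. cis (of_int (l - k) * t j)))"
    by (subst sum.swap) (simp add: sum_distrib_left)
  also have "\<dots> = (\<Sum>l\<in>{- int K..int K}. if l = k then c k * of_nat M else 0)"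
  proof (intro sum.cong refl)
    fix l assume l: "l \<in> {- int K..int K}"
    have "int M dvd l - k \<longleftrightarrow> l = k"
    proof
      assume "int M dvd l - k"
      moreover have "\<bar>l - k\<bar> < int M" using l k by (auto simp: M_def)
      ultimately show "l = k" using dvd_imp_le_int[of "l - k" "int M"] by auto
    qed auto
    then show "c l * (\<Sum>j<M. cis (of_int (l - k) * t j)) = (if l = k then c k * of_nat M else 0)"
      unfolding t_def sum_roots_of_unity[OF M] by auto
  qed
  also have "\<dots> = c k * of_nat M" using k by (simp add: abs_le_iff)
  finally have "real M * cmod (c k) = cmod (\<Sum>j<M. F (t j) * cis (of_int (- k) * t j))"
    by (simp add: norm_mult)
  also have "\<dots> \<le> (\<Sum>j<M. 1)" by (intro sum_norm_le) (simp add: norm_mult bound)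
  finally show ?thesis using M by simp
qed

text \<open>The coefficients of \<open>cos (2 h \<theta>)\<close> as a polynomial in \<open>sin\<^sup>2 \<theta>\<close>: a shifted Chebyshev polynomial.\<close>
definition cheb_coeff :: "nat \<Rightarrow> nat \<Rightarrow> real" where
  "cheb_coeff h j = (-4) ^ j / 2 * (real ((h + j) choose (2 * j)) + real ((h + j - 1) choose (2 * j)))"

text \<open>This compares coefficients in cos(2(h+2)t) + cos(2ht) = 2 cos(2t) cos(2(h+1)t), where
  cos(2t) = 1 - 2 s and s is the squared sine.\<close>

lemma cheb_coeff_rec:
  "cheb_coeff (Suc (Suc h)) (Suc j) + cheb_coeff h (Suc j) =
     2 * cheb_coeff (Suc h) (Suc j) - 4 * cheb_coeff (Suc h) j"
proof -
  \<comment> \<open>Pascal's rule applied twice. It is used for both binomials of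
    \<open>cheb_coeff\<close>, at \<open>n = h + Suc j\<close> and \<open>n = h + j\<close>.\<close>
  have P: "real (Suc (Suc n) choose Suc (Suc k)) + real (n choose Suc (Suc k))
      = 2 * real (Suc n choose Suc (Suc k)) + real (n choose k)" for n k
    by simp
  show ?thesis
  proof -
    let ?B = "\<lambda>n k. real (n choose k)"
    have "cheb_coeff (Suc (Suc h)) (Suc j) + cheb_coeff h (Suc j)
        - (2 * cheb_coeff (Suc h) (Suc j) - 4 * cheb_coeff (Suc h) j)
      = -2 * (-4) ^ j * (
          (?B (Suc (Suc (h + Suc j))) (Suc (Suc (2 * j))) + ?B (h + Suc j) (Suc (Suc (2 * j)))
            - (2 * ?B (Suc (h + Suc j)) (Suc (Suc (2 * j))) + ?B (h + Suc j) (2 * j)))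
        + (?B (Suc (Suc (h + j))) (Suc (Suc (2 * j))) + ?B (h + j) (Suc (Suc (2 * j)))
            - (2 * ?B (Suc (h + j)) (Suc (Suc (2 * j))) + ?B (h + j) (2 * j))))"
      unfolding cheb_coeff_def by (simp add: algebra_simps del: binomial_Suc_Suc)
    also have "\<dots> = 0" unfolding P by simp
    finally show ?thesis by simp
  qed
qed

lemma cheb_coeff_eq_0: "h < j \<Longrightarrow> cheb_coeff h j = 0"
  by (simp add: cheb_coeff_def binomial_eq_0)

lemma cheb_coeff_0: "cheb_coeff h 0 = 1"
  by (simp add: cheb_coeff_def)

text \<open>Induction along the three-term recurrence of the cosine. The upper limit
  \<open>H\<close> is free, since coefficients beyond \<open>h\<close> vanish; this lets expansions
  of different degree share one range.\<close>

lemma cos_even_multiple: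
  assumes "h \<le> H"
  shows "cos (2 * real h * \<theta>) = (\<Sum>j\<le>H. cheb_coeff h j * (sin \<theta>)\<^sup>2 ^ j)"
proof -
  define s where "s = (sin \<theta>)\<^sup>2"
  have c2: "cos (2 * \<theta>) = 1 - 2 * s" by (simp add: s_def cos_double_sin)
  have "cos (2 * real h * \<theta>) = (\<Sum>j\<le>H. cheb_coeff h j * s ^ j)" if "h \<le> H" for h H
    using that
  proof (induction h arbitrary: H rule: induct_nat_012)
    case 0
    have "(\<Sum>j\<le>H. cheb_coeff 0 j * s ^ j) = (\<Sum>j\<le>H. if j = 0 then 1 else 0)"
      by (intro sum.cong) (auto simp: cheb_coeff_0 cheb_coeff_eq_0)
    then show ?case by simp
  next
    case 1
    have "(\<Sum>j\<le>H. cheb_coeff (Suc 0) j * s ^ j) = (\<Sum>j\<in>{0,1}. cheb_coeff (Suc 0) j * s ^ j)"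
      by (rule sum.mono_neutral_right) (use 1 in \<open>auto simp: cheb_coeff_eq_0\<close>)
    then show ?case by (simp add: c2 cheb_coeff_def numeral_eq_Suc)
  next
    case (ge2 h)
    obtain G where G: "H = Suc G" using ge2.prems by (cases H) auto
    \<comment> \<open>The expansion with upper limit \<open>G\<close> is the one multiplied by
      \<open>s\<close>: that shifts its index by one, back to the limit \<open>H\<close>.\<close>
    have IH: "cos (2 * real h * \<theta>) = (\<Sum>j\<le>H. cheb_coeff h j * s ^ j)"
      "cos (2 * real (Suc h) * \<theta>) = (\<Sum>j\<le>H. cheb_coeff (Suc h) j * s ^ j)"
      "cos (2 * real (Suc h) * \<theta>) = (\<Sum>j\<le>G. cheb_coeff (Suc h) j * s ^ j)"
      using ge2.prems G by (intro ge2.IH; simp)+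
    have eq: "cos (2 * real (Suc (Suc h)) * \<theta>) =
        2 * cos (2 * real (Suc h) * \<theta>) - cos (2 * real h * \<theta>)
        - 4 * s * cos (2 * real (Suc h) * \<theta>)"
    proof -
      have "cos (2 * real (Suc (Suc h)) * \<theta>) + cos (2 * real h * \<theta>)
        = cos (2 * real (Suc h) * \<theta> + 2 * \<theta>) + cos (2 * real (Suc h) * \<theta> - 2 * \<theta>)"
        by (simp add: algebra_simps)
      also have "\<dots> = 2 * cos (2 * real (Suc h) * \<theta>) * cos (2 * \<theta>)"
        by (simp add: cos_add cos_diff)
      finally have "cos (2 * real (Suc (Suc h)) * \<theta>) =
          2 * cos (2 * real (Suc h) * \<theta>) * (1 - 2 * s) - cos (2 * real h * \<theta>)"
        unfolding c2 by linarith
      moreover have "2 * x * (1 - 2 * s) - y = 2 * x - y - 4 * s * x" for x y :: real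
        by (simp add: algebra_simps)
      ultimately show ?thesis by simp
    qed
    have "4 * s * cos (2 * real (Suc h) * \<theta>) = (\<Sum>j\<le>G. 4 * cheb_coeff (Suc h) j * s ^ Suc j)"
      unfolding IH(3) sum_distrib_left by (intro sum.cong) auto
    then have "cos (2 * real (Suc (Suc h)) * \<theta>) = (2 * cheb_coeff (Suc h) 0 - cheb_coeff h 0) +
        (\<Sum>j\<le>G. (2 * cheb_coeff (Suc h) (Suc j) - cheb_coeff h (Suc j)
           - 4 * cheb_coeff (Suc h) j) * s ^ Suc j)"
      unfolding eq IH(1,2) G sum.atMost_Suc_shift
      by (simp add: sum_distrib_left sum_subtractf sum.distrib algebra_simps)
    also have "\<dots> = cheb_coeff (Suc (Suc h)) 0 +
        (\<Sum>j\<le>G. cheb_coeff (Suc (Suc h)) (Suc j) * s ^ Suc j)"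
    proof -
      have "2 * cheb_coeff (Suc h) (Suc j) - cheb_coeff h (Suc j) - 4 * cheb_coeff (Suc h) j
          = cheb_coeff (Suc (Suc h)) (Suc j)" for j
        using cheb_coeff_rec[of h j] by linarith
      then show ?thesis by (simp add: cheb_coeff_0)
    qed
    finally show ?case unfolding G sum.atMost_Suc_shift by simp
  qed
  then show ?thesis using assms unfolding s_def by blast
qed

text \<open>For \<open>j\<close> up to \<open>h\<close> both binomials have upper index at most
  \<open>2 * h\<close>, so each is at most (2h)^(2j) / (2j)!, and the factor 4^j turns 2h into 4h.
  The factorial makes all but the first few coefficients negligible against small powers of the
  squared sine.\<close>

lemma abs_cheb_coeff_le: "\<bar>cheb_coeff h j\<bar> \<le> (4 * real h) ^ (2 * j) / fact (2 * j)"
proof (cases "j \<le> h")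
  case True
  have le: "real (n choose (2 * j)) \<le> (2 * real h) ^ (2 * j) / fact (2 * j)" if "n \<le> 2 * h" for n
  proof -
    have "real (n choose (2 * j)) * fact (2 * j) \<le> real n ^ (2 * j)"
      using binomial_fact_pow[of n "2 * j"] by (metis of_nat_fact of_nat_le_iff of_nat_mult of_nat_power)
    also have "\<dots> \<le> (2 * real h) ^ (2 * j)"
      using that by (intro power_mono) auto
    finally show ?thesis by (simp add: field_simps)
  qed
  have "\<bar>cheb_coeff h j\<bar> = 4 ^ j / 2 * (real ((h + j) choose (2 * j)) + real ((h + j - 1) choose (2 * j)))"
    by (simp add: cheb_coeff_def abs_mult power_abs)
  also have "\<dots> \<le> 4 ^ j / 2 * (2 * ((2 * real h) ^ (2 * j) / fact (2 * j)))"
  proof (intro mult_left_mono)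
    show "real ((h + j) choose (2 * j)) + real ((h + j - 1) choose (2 * j))
        \<le> 2 * ((2 * real h) ^ (2 * j) / fact (2 * j))"
    proof -
      have "h + j \<le> 2 * h" "h + j - 1 \<le> 2 * h" using True by auto
      from le[OF this(1)] le[OF this(2)] show ?thesis by linarith
    qed
  qed simp
  also have "\<dots> = (4 * real h) ^ (2 * j) / fact (2 * j)"
  proof -
    have "4 ^ j * (2 * real h) ^ (2 * j) = (4 * real h) ^ (2 * j)"
      unfolding power_mult power_mult_distrib[symmetric] by (simp add: power2_eq_square mult_ac)
    then show ?thesis by simp
  qed
  finally show ?thesis .
qed (simp add: cheb_coeff_eq_0)

text \<open>Averaging over the four angles with the same \<open>sin\<^sup>2\<close> leaves a polynomial in \<open>sin\<^sup>2\<close>,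
  whose coefficients of low degree are annihilated by the moment conditions.\<close>
lemma trig_poly_moment_bound:
  fixes \<Delta> \<theta> :: "'i \<Rightarrow> real"
  assumes F: "trig_poly K F" "\<And>\<theta>. cmod (F \<theta>) \<le> 1"
    and fin: "finite I"
    and moments: "\<And>j. j \<le> b \<Longrightarrow> (\<Sum>i\<in>I. \<Delta> i * (sin (\<theta> i))\<^sup>2 ^ j) = 0"
    and Z0: "0 \<le> Z" and Z: "\<And>i. i \<in> I \<Longrightarrow> (sin (\<theta> i))\<^sup>2 \<le> Z"
    and mass: "(\<Sum>i\<in>I. \<bar>\<Delta> i\<bar>) \<le> 2"
  shows "cmod (\<Sum>i\<in>I. of_real (\<Delta> i) *
           ((F (\<theta> i) + F (- \<theta> i) + F (pi - \<theta> i) + F (pi + \<theta> i)) / 4))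
       \<le> 2 * real (2 * K + 1) * (\<Sum>j\<in>{b<..K}. (2 * real K) ^ (2 * j) * Z ^ j / fact (2 * j))"
proof -
  obtain c where c: "\<And>\<theta>. F \<theta> = (\<Sum>k\<in>{- int K..int K}. c k * cis (of_int k * \<theta>))"
    using F(1) unfolding trig_poly_def by blast
  \<comment> \<open>In the average over the four angles the sines cancel between opposite angles,
    and the odd frequencies cancel under the shift by \<open>pi\<close>.\<close>
  define f where "f k t = (if even k then cos (of_int k * t) else 0)" for k :: int and t :: real
  define E where "E = (\<Sum>j\<in>{b<..K}. (2 * real K) ^ (2 * j) * Z ^ j / fact (2 * j))"
  have Ecis: "(cis (of_int k * t) + cis (of_int k * (- t)) + cis (of_int k * (pi - t)) +
      cis (of_int k * (pi + t))) / 4 = of_real (f k t)" for k t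
  proof -
    have cs: "cos (of_int k * pi) = (if even k then 1 else -1)" "sin (of_int k * pi) = 0"
      using cos_npi_int[of k] sin_npi_int[of k] by (simp_all add: mult.commute)
    show ?thesis
      by (simp add: complex_eq_iff f_def distrib_left right_diff_distrib cos_add cos_diff sin_add sin_diff cs)
  qed
  have avg: "(F t + F (- t) + F (pi - t) + F (pi + t)) / 4
      = (\<Sum>k\<in>{- int K..int K}. c k * of_real (f k t))" for t
    unfolding c Ecis[symmetric]
    by (simp add: sum.distrib[symmetric] sum_divide_distrib algebra_simps add_divide_distrib)
  have f: "\<bar>\<Sum>i\<in>I. \<Delta> i * f k (\<theta> i)\<bar> \<le> 2 * E" if k: "k \<in> {- int K..int K}" for k
  proof (cases "even k")
    case True
    \<comment> \<open>The frequency is 2h or -2h, which the cosine does not distinguish.\<close>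
    define h where "h = nat \<bar>k\<bar> div 2"
    have h2: "2 * h = nat \<bar>k\<bar>" using True by (simp add: h_def even_nat_iff)
    then have h: "\<bar>of_int k\<bar> = 2 * real h" by linarith
    have hK: "h \<le> K" "2 * h \<le> K" using h2 k by auto
    have fc: "f k t = (\<Sum>j\<le>K. cheb_coeff h j * (sin t)\<^sup>2 ^ j)" for t
    proof -
      have "f k t = cos (2 * real h * t)"
        using True h by (simp add: f_def) (metis abs_mult cos_abs_real abs_of_nat abs_numeral of_nat_numeral abs_mult_self_eq abs_abs)
      then show ?thesis using cos_even_multiple[OF hK(1)] by simp
    qed
    have "(\<Sum>i\<in>I. \<Delta> i * f k (\<theta> i))
        = (\<Sum>j\<le>K. cheb_coeff h j * (\<Sum>i\<in>I. \<Delta> i * (sin (\<theta> i))\<^sup>2 ^ j))"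
      unfolding fc sum_distrib_left by (subst sum.swap) (simp add: mult_ac)
    also have "\<dots> = (\<Sum>j\<in>{b<..K}. cheb_coeff h j * (\<Sum>i\<in>I. \<Delta> i * (sin (\<theta> i))\<^sup>2 ^ j))"
      by (rule sum.mono_neutral_right) (auto simp: moments not_less)
    finally have "\<bar>\<Sum>i\<in>I. \<Delta> i * f k (\<theta> i)\<bar>
        \<le> (\<Sum>j\<in>{b<..K}. \<bar>cheb_coeff h j\<bar> * \<bar>\<Sum>i\<in>I. \<Delta> i * (sin (\<theta> i))\<^sup>2 ^ j\<bar>)"
      by (simp add: abs_mult order_trans[OF sum_abs])
    also have "\<dots> \<le> (\<Sum>j\<in>{b<..K}. ((2 * real K) ^ (2 * j) / fact (2 * j)) * (2 * Z ^ j))"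
    proof (intro sum_mono mult_mono)
      fix j
      \<comment> \<open>Since \<open>2 * h\<close> is at most \<open>K\<close>, the base
        \<open>4 * h\<close> is at most \<open>2 * K\<close>.\<close>
      show "\<bar>cheb_coeff h j\<bar> \<le> (2 * real K) ^ (2 * j) / fact (2 * j)"
        using hK by (intro order_trans[OF abs_cheb_coeff_le] divide_right_mono power_mono) auto
      have "\<bar>\<Sum>i\<in>I. \<Delta> i * (sin (\<theta> i))\<^sup>2 ^ j\<bar> \<le> (\<Sum>i\<in>I. \<bar>\<Delta> i\<bar> * Z ^ j)"
        using Z by (intro order_trans[OF sum_abs] sum_mono) (auto simp: abs_mult intro!: mult_left_mono power_mono)
      also have "\<dots> \<le> 2 * Z ^ j"
        unfolding sum_distrib_right[symmetric] using mass Z0 by (intro mult_right_mono) auto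
      finally show "\<bar>\<Sum>i\<in>I. \<Delta> i * (sin (\<theta> i))\<^sup>2 ^ j\<bar> \<le> 2 * Z ^ j" .
    qed auto
    also have "\<dots> = 2 * E" by (simp add: E_def sum_distrib_left mult_ac)
    finally show ?thesis .
  next
    case False
    then show ?thesis using Z0 by (auto simp: f_def E_def intro!: sum_nonneg)
  qed
  have "(\<Sum>i\<in>I. of_real (\<Delta> i) * ((F (\<theta> i) + F (- \<theta> i) + F (pi - \<theta> i) + F (pi + \<theta> i)) / 4))
      = (\<Sum>k\<in>{- int K..int K}. c k * of_real (\<Sum>i\<in>I. \<Delta> i * f k (\<theta> i)))"
    unfolding avg sum_distrib_left of_real_sum by (subst sum.swap) (simp add: mult_ac)
  \<comment> \<open>There are \<open>2 * K + 1\<close> frequencies, and boundedness of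
    \<open>F\<close> limits each coefficient to modulus 1.\<close>
  also have "cmod \<dots> \<le> (\<Sum>k\<in>{- int K..int K}. 1 * (2 * E))"
  proof (intro sum_norm_le)
    fix k assume k: "k \<in> {- int K..int K}"
    then have "cmod (c k) \<le> 1" by (intro trig_poly_coeff_bound[OF c F(2)]) auto
    then show "cmod (c k * of_real (\<Sum>i\<in>I. \<Delta> i * f k (\<theta> i))) \<le> 1 * (2 * E)"
      unfolding norm_mult norm_of_real using f[OF k] by (intro mult_mono) auto
  qed
  also have "\<dots> = 2 * real (2 * K + 1) * E" by simp
  finally show ?thesis unfolding E_def .
qed

section \<open>Quantum algorithms with a reflection oracle\<close>

lemma sum_blocks:
  fixes f :: "nat \<Rightarrow> 'a::comm_monoid_add"
  shows "(\<Sum>c<N * k. f c) = (\<Sum>y<N. \<Sum>w<k. f (y * k + w))"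
proof -
  have split: "(\<Sum>c<a + k. f c) = (\<Sum>c<a. f c) + (\<Sum>w<k. f (a + w))" for a k
    by (induction k) (simp_all add: add.assoc)
  show ?thesis
    by (induction N) (simp_all add: split add.commute[of k])
qed

lemma block_index_less: "x < N \<Longrightarrow> w < k \<Longrightarrow> x * k + w < N * (k::nat)"
proof -
  assume "x < N" "w < k"
  then have "x * k + w < Suc x * k" by simp
  also have "\<dots> \<le> N * k" using \<open>x < N\<close> by (intro mult_le_mono1) simp
  finally show ?thesis .
qed

definition sqnorm :: "complex vec \<Rightarrow> real" where
  "sqnorm v = (\<Sum>i<dim_vec v. (cmod (v $ i))\<^sup>2)"

lemma mult_mat_vec_index:
  assumes "M \<in> carrier_mat N K" "v \<in> carrier_vec K" "i < N"
  shows "(M *\<^sub>v v) $ i = (\<Sum>j<K. M $$ (i, j) * v $ j)"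
  using assms by (auto simp: scalar_prod_def lessThan_atLeast0 intro!: sum.cong)

lemma isometry_sqnorm:
  fixes u :: "nat \<Rightarrow> nat \<Rightarrow> complex"
  assumes gram: "\<And>j k. j < N \<Longrightarrow> k < N \<Longrightarrow> (\<Sum>i<N. cnj (u i j) * u i k) = (if j = k then 1 else 0)"
  shows "(\<Sum>i<N. (cmod (\<Sum>j<N. u i j * v j))\<^sup>2) = (\<Sum>j<N. (cmod (v j))\<^sup>2)"
proof -
  have sq: "complex_of_real ((cmod z)\<^sup>2) = cnj z * z" for z
    by (simp only: complex_norm_square mult.commute)
  have "complex_of_real (\<Sum>i<N. (cmod (\<Sum>j<N. u i j * v j))\<^sup>2)
      = (\<Sum>i<N. \<Sum>j<N. \<Sum>k<N. cnj (v j) * v k * (cnj (u i j) * u i k))"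
    unfolding of_real_sum sq cnj_sum complex_cnj_mult sum_product
    by (intro sum.cong refl) (simp only: mult_ac)
  also have "\<dots> = (\<Sum>j<N. \<Sum>k<N. \<Sum>i<N. cnj (v j) * v k * (cnj (u i j) * u i k))"
    by (subst sum.swap) (rule sum.cong[OF refl], subst sum.swap, rule refl)
  also have "\<dots> = (\<Sum>j<N. \<Sum>k<N. cnj (v j) * v k * (if j = k then 1 else 0))"
    unfolding sum_distrib_left[symmetric] by (intro sum.cong refl) (simp add: gram)
  also have "\<dots> = complex_of_real (\<Sum>j<N. (cmod (v j))\<^sup>2)"
    unfolding of_real_sum sq by (intro sum.cong refl) (simp add: if_distrib cong: if_cong)
  finally show ?thesis unfolding of_real_eq_iff .
qed

lemma is_unitary_gram:
  assumes "is_unitary N U" "j < N" "k < N"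
  shows "(\<Sum>i<N. cnj (U $$ (i, j)) * U $$ (i, k)) = (if j = k then 1 else 0)"
proof -
  have U: "U \<in> carrier_mat N N" "adj U * U = 1\<^sub>m N" using assms(1) by (auto simp: is_unitary_def)
  have "(adj U * U) $$ (j, k) = (\<Sum>i<N. cnj (U $$ (i, j)) * U $$ (i, k))"
    using U(1) assms(2,3)
    by (auto simp: adj_def scalar_prod_def lessThan_atLeast0 intro!: sum.cong)
  then show ?thesis using U(2) assms(2,3) by simp
qed

lemma sqnorm_unitary:
  assumes "is_unitary N U" "v \<in> carrier_vec N"
  shows "sqnorm (U *\<^sub>v v) = sqnorm v"
proof -
  have U: "U \<in> carrier_mat N N" using assms(1) by (auto simp: is_unitary_def)
  have "sqnorm (U *\<^sub>v v) = (\<Sum>i<N. (cmod (\<Sum>j<N. U $$ (i, j) * v $ j))\<^sup>2)"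
    unfolding sqnorm_def using U assms(2) by (auto simp: mult_mat_vec_index[OF U assms(2)] intro!: sum.cong simp del: index_mult_mat_vec)
  also have "\<dots> = (\<Sum>j<N. (cmod (v $ j))\<^sup>2)"
    by (rule isometry_sqnorm) (rule is_unitary_gram[OF assms(1)])
  finally show ?thesis using assms(2) by (simp add: sqnorm_def)
qed

lemma sqnorm_block_diagonal:
  assumes M: "M \<in> carrier_mat (N * k) (N * k)" and v: "v \<in> carrier_vec (N * k)"
    and blocks: "\<And>x w y w'. x < N \<Longrightarrow> w < k \<Longrightarrow> y < N \<Longrightarrow> w' < k \<Longrightarrow>
       M $$ (x * k + w, y * k + w') = (if w = w' then G w x y else 0)"
    and gram: "\<And>w i j. w < k \<Longrightarrow> i < N \<Longrightarrow> j < N \<Longrightarrow>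
       (\<Sum>x<N. cnj (G w x i) * G w x j) = (if i = j then 1 else 0)"
  shows "sqnorm (M *\<^sub>v v) = sqnorm v"
proof -
  have entry: "(M *\<^sub>v v) $ (x * k + w) = (\<Sum>y<N. G w x y * v $ (y * k + w))"
    if "x < N" "w < k" for x w
  proof -
    have "(M *\<^sub>v v) $ (x * k + w) = (\<Sum>y<N. \<Sum>w'<k. M $$ (x * k + w, y * k + w') * v $ (y * k + w'))"
      using block_index_less[OF that] by (simp add: mult_mat_vec_index[OF M v] sum_blocks)
    also have "\<dots> = (\<Sum>y<N. \<Sum>w'<k. if w = w' then G w x y * v $ (y * k + w') else 0)"
      using that by (intro sum.cong refl) (auto simp: blocks)
    also have "\<dots> = (\<Sum>y<N. G w x y * v $ (y * k + w))" using that by simp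
    finally show ?thesis .
  qed
  have "sqnorm (M *\<^sub>v v) = (\<Sum>x<N. \<Sum>w<k. (cmod (\<Sum>y<N. G w x y * v $ (y * k + w)))\<^sup>2)"
    using M by (simp add: sqnorm_def sum_blocks entry del: index_mult_mat_vec)
  also have "\<dots> = (\<Sum>w<k. \<Sum>y<N. (cmod (v $ (y * k + w)))\<^sup>2)"
    by (subst sum.swap) (intro sum.cong refl isometry_sqnorm, auto simp: gram)
  also have "\<dots> = sqnorm v" using v by (simp add: sqnorm_def sum_blocks) (rule sum.swap)
  finally show ?thesis .
qed

lemma sqnorm_lift_op:
  assumes "is_unitary N U" "v \<in> carrier_vec (N * k)"
  shows "sqnorm (lift_op k U *\<^sub>v v) = sqnorm v"
proof (rule sqnorm_block_diagonal[where G = "\<lambda>w x y. U $$ (x, y)"])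
  have U: "U \<in> carrier_mat N N" using assms(1) by (auto simp: is_unitary_def)
  then show "lift_op k U \<in> carrier_mat (N * k) (N * k)" by (auto simp: lift_op_def)
  show "lift_op k U $$ (x * k + w, y * k + w') = (if w = w' then U $$ (x, y) else 0)"
    if "x < N" "w < k" "y < N" "w' < k" for x w y w'
    using U that by (simp add: lift_op_def block_index_less)
qed (use assms is_unitary_gram in auto)

lemma sqnorm_ctrl_op:
  assumes "is_unitary N U" "v \<in> carrier_vec (N * k)"
  shows "sqnorm (ctrl_op k U *\<^sub>v v) = sqnorm v"
proof (rule sqnorm_block_diagonal
    [where G = "\<lambda>w x y. if odd w then U $$ (x, y) else if x = y then 1 else 0"])
  have U: "U \<in> carrier_mat N N" using assms(1) by (auto simp: is_unitary_def)
  then show "ctrl_op k U \<in> carrier_mat (N * k) (N * k)" by (auto simp: ctrl_op_def)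
  show "ctrl_op k U $$ (x * k + w, y * k + w') =
      (if w = w' then if odd w then U $$ (x, y) else if x = y then 1 else 0 else 0)"
    if "x < N" "w < k" "y < N" "w' < k" for x w y w'
    using U that by (simp add: ctrl_op_def block_index_less)
  show "(\<Sum>x<N. cnj (if odd w then U $$ (x, i) else if x = i then 1 else 0) *
      (if odd w then U $$ (x, j) else if x = j then 1 else 0)) = (if i = j then 1 else 0)"
    if "w < k" "i < N" "j < N" for w i j
  proof (cases "odd w")
    case True
    then show ?thesis using is_unitary_gram[OF assms(1) that(2,3)] by simp
  next
    case False
    then have "?thesis \<longleftrightarrow> (\<Sum>x<N. if x = i then if i = j then 1 else 0 else 0) = (if i = j then 1 else (0::complex))"
      by (intro arg_cong2[where f = "(=)"] sum.cong refl) auto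
    then show ?thesis using that by simp
  qed
qed (use assms in auto)

lemma adj_adj: "adj (adj U) = U"
  by (auto simp: adj_def)

lemma is_unitary_adj: "is_unitary N U \<Longrightarrow> is_unitary N (adj U)"
  unfolding is_unitary_def adj_adj by (auto simp: adj_def)

lemma query_op_carrier:
  assumes "U \<in> carrier_mat N N"
  shows "query_op k q U \<in> carrier_mat (N * k) (N * k)"
  using assms by (cases q) (auto simp: lift_op_def ctrl_op_def adj_def)

lemma sqnorm_query_op:
  assumes "is_unitary N U" "v \<in> carrier_vec (N * k)"
  shows "sqnorm (query_op k q U *\<^sub>v v) = sqnorm v"
  using sqnorm_lift_op[OF assms] sqnorm_ctrl_op[OF assms]
    sqnorm_lift_op[OF is_unitary_adj[OF assms(1)] assms(2)]
    sqnorm_ctrl_op[OF is_unitary_adj[OF assms(1)] assms(2)]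
  by (cases q) simp_all

lemma gates_carrier:
  "well_formed_alg n m A \<Longrightarrow> t \<le> nqueries A \<Longrightarrow>
     gates A t \<in> carrier_mat (n * m * wdim A) (n * m * wdim A)"
  by (auto simp: well_formed_alg_def is_unitary_def)

lemma run_state_carrier:
  assumes "well_formed_alg n m A" "t \<le> nqueries A"
  shows "run_state n m A U t \<in> carrier_vec (n * m * wdim A)"
  using carrier_matD(1)[OF gates_carrier[OF assms]] by (intro carrier_vecI) (cases t; simp)

text \<open>This makes the squared amplitudes a probability distribution, which gives the bound by 1
  and the complement rule for \<open>prob_output\<close>.\<close>

lemma sqnorm_run_state:
  assumes A: "well_formed_alg n m A" and U: "is_unitary (n * m) U" and pos: "0 < n * m"
  shows "t \<le> nqueries A \<Longrightarrow> sqnorm (run_state n m A U t) = 1"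
proof (induction t)
  case 0
  have "0 < n * m * wdim A" using A pos by (auto simp: well_formed_alg_def)
  moreover have "sqnorm (unit_vec D 0) = (\<Sum>i<D. if i = 0 then 1 else 0)" for D
    unfolding sqnorm_def by (intro sum.cong) auto
  ultimately have "sqnorm (unit_vec (n * m * wdim A) 0) = 1" by simp
  then show ?case
    using A by (simp add: sqnorm_unitary[where N = "n * m * wdim A"] well_formed_alg_def)
next
  case (Suc t)
  have U': "U \<in> carrier_mat (n * m) (n * m)" using U by (simp add: is_unitary_def)
  have c: "run_state n m A U t \<in> carrier_vec (n * m * wdim A)"
    using run_state_carrier[OF A] Suc.prems by simp
  then have "query_op (wdim A) (qtypes A t) U *\<^sub>v run_state n m A U t \<in> carrier_vec (n * m * wdim A)"
    using query_op_carrier[OF U'] by (rule mult_mat_vec_carrier[rotated])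
  then show ?case
    using A Suc c by (simp add: sqnorm_unitary[where N = "n * m * wdim A"] sqnorm_query_op[OF U] well_formed_alg_def)
qed

lemma prob_output_nonneg: "0 \<le> prob_output n m A U S"
  by (simp add: prob_output_def sum_nonneg)

lemma prob_output_mono:
  "(\<And>x. S x \<Longrightarrow> S' x) \<Longrightarrow> prob_output n m A U S \<le> prob_output n m A U S'"
  unfolding prob_output_def by (rule sum_mono2) auto

lemma prob_output_compl:
  assumes A: "well_formed_alg n m A" and U: "is_unitary (n * m) U" and pos: "0 < n * m"
  shows "prob_output n m A U S + prob_output n m A U (\<lambda>x. \<not> S x) = 1"
proof -
  let ?D = "n * m * wdim A" and ?g = "\<lambda>j. (cmod (final_state n m A U $ j))\<^sup>2"
  have "prob_output n m A U S + prob_output n m A U (\<lambda>x. \<not> S x)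
      = (\<Sum>j\<in>{j. j < ?D \<and> S (outmap A j)} \<union> {j. j < ?D \<and> \<not> S (outmap A j)}. ?g j)"
    unfolding prob_output_def by (rule sum.union_disjoint[symmetric]) auto
  also have "\<dots> = (\<Sum>j<?D. ?g j)" by (rule sum.cong) auto
  also have "\<dots> = sqnorm (final_state n m A U)"
    using run_state_carrier[OF A, of "nqueries A" U] by (simp add: sqnorm_def final_state_def)
  also have "\<dots> = 1" using sqnorm_run_state[OF A U pos] by (simp add: final_state_def)
  finally show ?thesis .
qed

lemma prob_output_le_1:
  assumes "well_formed_alg n m A" "is_unitary (n * m) U" "0 < n * m"
  shows "prob_output n m A U S \<le> 1"
  using prob_output_compl[OF assms, of S] prob_output_nonneg[of n m A U "\<lambda>x. \<not> S x"] by linarith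

section \<open>A self-adjoint oracle from a Householder reflection\<close>

definition reflection :: "nat \<Rightarrow> (nat \<Rightarrow> real) \<Rightarrow> complex mat" where
  "reflection D w = mat D D (\<lambda>(a, c). of_real ((if a = c then 1 else 0) - w a * w c))"

text \<open>The matrix is real and symmetric. Hence queries to the adjoint coincide with queries to
  the oracle and need no separate degree analysis.\<close>

lemma adj_reflection: "adj (reflection D w) = reflection D w"
  by (auto simp: adj_def reflection_def)

text \<open>The square of I - w w^T is I - 2 w w^T + |w|^2 w w^T, and squared norm 2 cancels the
  last two terms.\<close>

lemma is_unitary_reflection:
  assumes "(\<Sum>q<D. (w q)\<^sup>2) = 2"
  shows "is_unitary D (reflection D w)"
proof -
  have "reflection D w * reflection D w = 1\<^sub>m D"
  proof (rule eq_matI)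
    fix a c assume "a < dim_row (1\<^sub>m D :: complex mat)" "c < dim_col (1\<^sub>m D :: complex mat)"
    then have ac: "a < D" "c < D" by auto
    let ?\<delta> = "\<lambda>a c. if a = c then 1 else (0::real)"
    have "(\<Sum>k<D. (?\<delta> a k - w a * w k) * (?\<delta> k c - w k * w c))
      = (\<Sum>k<D. (if a = k then ?\<delta> a c - w a * w c else 0)
           - (if k = c then w a * w c else 0) + w a * w c * (w k)\<^sup>2)"
      by (intro sum.cong refl) (auto simp: algebra_simps power2_eq_square)
    also have "\<dots> = ?\<delta> a c"
      using ac assms by (simp add: sum.distrib sum_subtractf sum_distrib_left[symmetric])
    finally have eq: "(\<Sum>k<D. (?\<delta> a k - w a * w k) * (?\<delta> k c - w k * w c)) = ?\<delta> a c" .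
    have "(reflection D w * reflection D w) $$ (a, c)
        = (\<Sum>k<D. reflection D w $$ (a, k) * reflection D w $$ (k, c))"
      using ac by (simp add: reflection_def scalar_prod_def lessThan_atLeast0)
    also have "\<dots> = of_real (\<Sum>k<D. (?\<delta> a k - w a * w k) * (?\<delta> k c - w k * w c))"
      unfolding of_real_sum of_real_mult using ac by (intro sum.cong refl) (simp add: reflection_def)
    finally show "(reflection D w * reflection D w) $$ (a, c) = 1\<^sub>m D $$ (a, c)"
      unfolding eq using ac by simp
  qed (simp_all add: reflection_def)
  then show ?thesis unfolding is_unitary_def adj_reflection by (simp add: reflection_def)
qed

text \<open>The Householder reflection that exchanges \<open>|0\<rangle>|0\<rangle>\<close> and \<open>\<Sum>i v\<^sub>i |i\<rangle>|i+1\<rangle>\<close>;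
  the shift by one makes the two vectors orthogonal.\<close>
definition swap_vec :: "nat \<Rightarrow> (nat \<Rightarrow> real) \<Rightarrow> nat \<Rightarrow> real" where
  "swap_vec m v q = (if q = 0 then 1 else if q mod m = Suc (q div m) then - v (q div m) else 0)"

definition swap_oracle :: "nat \<Rightarrow> (nat \<Rightarrow> real) \<Rightarrow> complex mat" where
  "swap_oracle N v = reflection (N * Suc N) (swap_vec (Suc N) v)"

lemma swap_vec_block:
  assumes "b < m"
  shows "swap_vec m v (i * m + b) = (if i * m + b = 0 then 1 else if b = Suc i then - v i else 0)"
proof -
  have block: "(i * m + b) div m = i" "(i * m + b) mod m = b" using assms by simp_all
  show ?thesis by (simp only: swap_vec_def block)
qed

text \<open>Index 0 contributes 1. The positions carrying \<open>v\<close> have second index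
  \<open>Suc i\<close>, hence avoid index 0, and contribute another 1.\<close>

lemma sum_swap_vec_squares:
  assumes v: "(\<Sum>i<N. (v i)\<^sup>2) = 1" and N: "0 < N"
  shows "(\<Sum>q<N * Suc N. (swap_vec (Suc N) v q)\<^sup>2) = 2"
proof -
  have "(\<Sum>q<N * Suc N. (swap_vec (Suc N) v q)\<^sup>2)
      = (\<Sum>i<N. \<Sum>b<Suc N. (if i = 0 \<and> b = 0 then 1 else 0) + (if b = Suc i then (v i)\<^sup>2 else 0))"
    unfolding sum_blocks
    by (intro sum.cong refl) (auto simp: swap_vec_block simp del: mult_Suc_right)
  also have "\<dots> = (\<Sum>i<N. (if i = 0 then 1 else 0) + (v i)\<^sup>2)"
  proof (rule sum.cong[OF refl])
    fix i assume "i \<in> {..<N}"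
    moreover have "(\<Sum>b<Suc N. if i = 0 \<and> b = 0 then 1 else 0) = (if i = 0 then 1 else (0::real))"
      by (cases "i = 0") simp_all
    ultimately show "(\<Sum>b<Suc N. (if i = 0 \<and> b = 0 then 1 else 0) + (if b = Suc i then (v i)\<^sup>2 else 0))
        = (if i = 0 then 1 else 0) + (v i)\<^sup>2"
      by (simp only: sum.distrib) simp
  qed
  also have "\<dots> = 2" using v N by (simp add: sum.distrib)
  finally show ?thesis .
qed

lemma is_unitary_swap_oracle:
  "(\<Sum>i<N. (v i)\<^sup>2) = 1 \<Longrightarrow> 0 < N \<Longrightarrow> is_unitary (N * Suc N) (swap_oracle N v)"
  unfolding swap_oracle_def by (intro is_unitary_reflection sum_swap_vec_squares)

text \<open>A purification prescribes the nonnegative amplitude \<open>sqrt (p i)\<close>, so the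
  sign of \<open>v i\<close> is moved into the unit vector of register B. Every sign pattern
  therefore gives an admissible oracle for the same distribution.\<close>

lemma purified_oracle_swap_oracle:
  assumes "(\<Sum>i<N. (v i)\<^sup>2) = 1" "0 < N"
  shows "purified_oracle N (Suc N) (\<lambda>i. (v i)\<^sup>2) (swap_oracle N v)"
proof -
  define \<psi> where "\<psi> i = vec (Suc N) (\<lambda>b. if b = Suc i then if v i < 0 then -1 else 1 else (0::complex))" for i
  have "cinner (\<psi> i) (\<psi> j) = (if i = j then 1 else 0)" if "i < N" "j < N" for i j
  proof -
    have "cinner (\<psi> i) (\<psi> j) = (\<Sum>b<Suc N. if b = Suc i then if i = j then 1 else 0 else 0)"
      unfolding cinner_def by (intro sum.cong) (auto simp: \<psi>_def)
    then show ?thesis using that by simp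
  qed
  moreover have "swap_oracle N v $$ (i * Suc N + b, 0) = complex_of_real (sqrt ((v i)\<^sup>2)) * \<psi> i $ b"
    if i: "i < N" "b < Suc N" for i b
  proof -
    have "i * Suc N + b < N * Suc N" using i by (rule block_index_less)
    moreover have "0 < N * Suc N" using assms(2) by simp
    \<comment> \<open>As \<open>swap_vec\<close> is 1 at index 0, column 0 is the zeroth basis
      vector minus \<open>swap_vec\<close>; the entry at index 0 cancels.\<close>
    ultimately have "swap_oracle N v $$ (i * Suc N + b, 0) =
        of_real ((if i * Suc N + b = 0 then 1 else 0) - swap_vec (Suc N) v (i * Suc N + b) * swap_vec (Suc N) v 0)"
      by (simp add: swap_oracle_def reflection_def)
    also have "\<dots> = of_real (if b = Suc i then v i else 0)"
      using i by (simp only: swap_vec_block) (auto simp: swap_vec_def)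
    also have "\<dots> = complex_of_real (sqrt ((v i)\<^sup>2)) * \<psi> i $ b"
      using i by (auto simp: \<psi>_def)
    finally show ?thesis .
  qed
  ultimately show ?thesis
    unfolding purified_oracle_def using is_unitary_swap_oracle[OF assms]
    by (intro conjI exI[of _ \<psi>]) (auto simp: \<psi>_def)
qed

section \<open>Acceptance probabilities as trigonometric polynomials\<close>

lemma trig_poly_swap_oracle:
  assumes v: "\<And>i. trig_poly 1 (\<lambda>\<theta>. of_real (v \<theta> i))" and "a < N * Suc N" "c < N * Suc N"
  shows "trig_poly 2 (\<lambda>\<theta>. swap_oracle N (v \<theta>) $$ (a, c))"
proof -
  have w: "trig_poly 1 (\<lambda>\<theta>. of_real (swap_vec (Suc N) (v \<theta>) q))" for q
  proof -
    have "trig_poly 1 (\<lambda>\<theta>. of_real (- v \<theta> (q div Suc N)))"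
      using trig_poly_mult[OF trig_poly_const[of 0 "-1"] v[of "q div Suc N"]] by simp
    then show ?thesis
      by (cases "q = 0"; cases "q mod Suc N = Suc (q div Suc N)")
        (simp_all add: swap_vec_def trig_poly_const del: One_nat_def)
  qed
  have "trig_poly 2 (\<lambda>\<theta>. (if a = c then 1 else 0) + (-1) *
      (of_real (swap_vec (Suc N) (v \<theta>) a) * of_real (swap_vec (Suc N) (v \<theta>) c)))"
    using trig_poly_mult[OF trig_poly_const[of 0 "-1"] trig_poly_mult[OF w[of a] w[of c]]]
    by (intro trig_poly_add trig_poly_const) (simp add: numeral_2_eq_2)
  then show ?thesis
    using assms(2,3) by (cases "a = c") (simp_all add: swap_oracle_def reflection_def del: mult_Suc_right)
qed

lemma trig_poly_if:
  "(P \<Longrightarrow> trig_poly K f) \<Longrightarrow> (\<not> P \<Longrightarrow> trig_poly K g) \<Longrightarrow>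
     trig_poly K (\<lambda>\<theta>. if P then f \<theta> else g \<theta>)"
  by (cases P) simp_all

lemma trig_poly_query_op:
  assumes "\<And>\<theta>. U \<theta> \<in> carrier_mat N N" "\<And>\<theta>. adj (U \<theta>) = U \<theta>"
    and "\<And>a c. a < N \<Longrightarrow> c < N \<Longrightarrow> trig_poly K (\<lambda>\<theta>. U \<theta> $$ (a, c))"
    and "r < N * k" "c < N * k"
  shows "trig_poly K (\<lambda>\<theta>. query_op k q (U \<theta>) $$ (r, c))"
proof -
  have d: "dim_row (U \<theta>) = N" "dim_col (U \<theta>) = N" for \<theta> using assms(1)[of \<theta>] by auto
  have "r div k < N" "c div k < N" using assms(4,5) by (auto simp: less_mult_imp_div_less)
  then have "trig_poly K (\<lambda>\<theta>. U \<theta> $$ (r div k, c div k))" by (rule assms(3))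
  then show ?thesis
    using assms(4,5) by (cases q) (auto simp: assms(2) lift_op_def ctrl_op_def d intro!: trig_poly_if trig_poly_const)
qed

lemma trig_poly_mult_mat_vec:
  assumes "\<And>\<theta>. M \<theta> \<in> carrier_mat D D" "\<And>\<theta>. u \<theta> \<in> carrier_vec D"
    and "\<And>i j. i < D \<Longrightarrow> j < D \<Longrightarrow> trig_poly K (\<lambda>\<theta>. M \<theta> $$ (i, j))"
    and "\<And>j. j < D \<Longrightarrow> trig_poly L (\<lambda>\<theta>. u \<theta> $ j)"
    and "i < D"
  shows "trig_poly (K + L) (\<lambda>\<theta>. (M \<theta> *\<^sub>v u \<theta>) $ i)"
  unfolding mult_mat_vec_index[OF assms(1,2,5)]
  by (intro trig_poly_sum trig_poly_mult assms) (use assms(5) in auto)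

text \<open>The polynomial method: oracle entries are quadratic in the amplitudes \<open>v\<close>,
  so each query raises the degree by 2, while the gates are constant in the angle.\<close>

lemma trig_poly_run_state:
  assumes A: "well_formed_alg N (Suc N) A"
    and v: "\<And>i. trig_poly 1 (\<lambda>\<theta>. of_real (v \<theta> i))"
  shows "t \<le> nqueries A \<Longrightarrow> i < N * Suc N * wdim A \<Longrightarrow>
    trig_poly (2 * t) (\<lambda>\<theta>. run_state N (Suc N) A (swap_oracle N (v \<theta>)) t $ i)"
proof (induction t arbitrary: i)
  case 0
  then show ?case by (simp only: run_state.simps trig_poly_const)
next
  case (Suc t)
  let ?D = "N * Suc N * wdim A" and ?U = "\<lambda>\<theta>. swap_oracle N (v \<theta>)"
  have U: "?U \<theta> \<in> carrier_mat (N * Suc N) (N * Suc N)" "adj (?U \<theta>) = ?U \<theta>" for \<theta>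
    by (auto simp: swap_oracle_def adj_reflection) (simp add: reflection_def)
  have q: "query_op (wdim A) (qtypes A t) (?U \<theta>) \<in> carrier_mat ?D ?D" for \<theta>
    by (rule query_op_carrier[OF U(1)])
  have s: "run_state N (Suc N) A (?U \<theta>) t \<in> carrier_vec ?D" for \<theta>
    using Suc.prems by (intro run_state_carrier[OF A]) auto
  have "trig_poly (2 + 2 * t) (\<lambda>\<theta>. (query_op (wdim A) (qtypes A t) (?U \<theta>) *\<^sub>v
      run_state N (Suc N) A (?U \<theta>) t) $ j)" if "j < ?D" for j
    using Suc.prems(1) that
    by (intro trig_poly_mult_mat_vec[OF q s] Suc.IH trig_poly_query_op[OF U] trig_poly_swap_oracle[OF v])
       simp_all
  then have "trig_poly (0 + (2 + 2 * t)) (\<lambda>\<theta>. (gates A (Suc t) *\<^sub>v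
      (query_op (wdim A) (qtypes A t) (?U \<theta>) *\<^sub>v run_state N (Suc N) A (?U \<theta>) t)) $ i)"
    by (intro trig_poly_mult_mat_vec[OF gates_carrier[OF A Suc.prems(1)] mult_mat_vec_carrier[OF q s]]
        trig_poly_const Suc.prems)
  then show ?case by simp
qed

text \<open>A probability is an amplitude times its conjugate, which doubles the degree 2T reached
  after T queries.\<close>

lemma trig_poly_prob_output:
  assumes A: "well_formed_alg N (Suc N) A"
    and v: "\<And>i. trig_poly 1 (\<lambda>\<theta>. of_real (v \<theta> i))"
  shows "trig_poly (4 * nqueries A) (\<lambda>\<theta>. of_real (prob_output N (Suc N) A (swap_oracle N (v \<theta>)) S))"
proof -
  have "trig_poly (4 * nqueries A) (\<lambda>\<theta>. complex_of_real ((cmod (final_state N (Suc N) A (swap_oracle N (v \<theta>)) $ j))\<^sup>2))"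
    if "j < N * Suc N * wdim A" for j
    using trig_poly_mult[OF trig_poly_run_state[OF A v order_refl that]
        trig_poly_cnj[OF trig_poly_run_state[OF A v order_refl that]]]
    unfolding final_state_def complex_norm_square by simp
  then show ?thesis unfolding prob_output_def of_real_sum by (intro trig_poly_sum) auto
qed

section \<open>Moment matching\<close>

lemma cis_half_turns: "cis (pi * real j) = (-1) ^ j"
  by (induction j) (simp_all add: complex_eq_iff distrib_left cos_add sin_add)

text \<open>On the \<open>2 * r\<close>-th roots of unity the alternating sign is the character of
  frequency \<open>r\<close>. Shifting a frequency of modulus below \<open>r\<close> by
  \<open>r\<close> never gives a multiple of \<open>2 * r\<close>, so every character sum
  vanishes.\<close>

lemma trig_poly_alternating_sum:
  assumes "trig_poly K f" "K < r"
  shows "(\<Sum>j<2 * r. (-1) ^ j * f (2 * pi * real j / real (2 * r))) = 0"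
proof -
  define t where "t j = 2 * pi * real j / real (2 * r)" for j
  have r: "0 < 2 * r" using assms(2) by simp
  obtain c where c: "\<And>\<theta>. f \<theta> = (\<Sum>k\<in>{- int K..int K}. c k * cis (of_int k * \<theta>))"
    using assms(1) unfolding trig_poly_def by blast
  have sgn: "(-1) ^ j = cis (of_int (int r) * t j)" for j
    using r by (simp add: t_def cis_half_turns[symmetric])
  have "(\<Sum>j<2 * r. (-1) ^ j * f (t j))
      = (\<Sum>j<2 * r. \<Sum>k\<in>{- int K..int K}. c k * cis (of_int (int r + k) * t j))"
    unfolding sgn c sum_distrib_left
    by (intro sum.cong refl) (simp add: mult.left_commute cis_mult distrib_right)
  also have "\<dots> = (\<Sum>k\<in>{- int K..int K}. c k * (\<Sum>j<2 * r. cis (of_int (int r + k) * t j)))"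
    by (subst sum.swap) (simp add: sum_distrib_left)
  also have "\<dots> = 0"
  proof (intro sum.neutral ballI)
    fix k assume k: "k \<in> {- int K..int K}"
    have "\<not> int (2 * r) dvd int r + k"
    proof
      assume "int (2 * r) dvd int r + k"
      then have "int (2 * r) \<le> int r + k" using k assms(2) by (intro zdvd_imp_le) auto
      then show False using k assms(2) by auto
    qed
    then show "c k * (\<Sum>j<2 * r. cis (of_int (int r + k) * t j)) = 0"
      unfolding t_def sum_roots_of_unity[OF r] by simp
  qed
  finally show ?thesis unfolding t_def .
qed

section \<open>Poisson and Fejer kernels on roots of unity\<close>

lemma poisson_kernel_at_root:
  assumes "0 < \<rho>" "\<rho> < 1" "0 < M" and e: "cis \<theta> ^ M = 1"
  shows "(1 - \<rho>\<^sup>2) / (1 - 2 * \<rho> * cos \<theta> + \<rho>\<^sup>2)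
       = 2 / (1 - \<rho> ^ M) * (\<Sum>k<M. \<rho> ^ k * cos (real k * \<theta>)) - 1"
proof -
  define C where "C = (\<Sum>k<M. \<rho> ^ k * cos (real k * \<theta>))"
  define D where "D = (\<Sum>k<M. \<rho> ^ k * sin (real k * \<theta>))"
  \<comment> \<open>The Poisson kernel is twice the real part of 1 / (1 - \<rho> e^(i\<theta>)),
    minus 1. At an \<open>M\<close>-th root of unity the geometric series is periodic up to powers
    of \<rho>^M, so its first \<open>M\<close> terms determine it.\<close>
  have S: "(\<Sum>k<M. (of_real \<rho> * cis \<theta>) ^ k) = Complex C D"
    unfolding C_def D_def power_mult_distrib DeMoivre
    by (simp add: complex_eq_iff flip: of_real_power)
  have "(1 - of_real \<rho> * cis \<theta>) * Complex C D = 1 - of_real (\<rho> ^ M)"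
    unfolding S[symmetric] one_diff_power_eq[symmetric] by (simp add: e power_mult_distrib)
  then have eqs: "(1 - \<rho> * cos \<theta>) * C + \<rho> * sin \<theta> * D = 1 - \<rho> ^ M"
    "(1 - \<rho> * cos \<theta>) * D - \<rho> * sin \<theta> * C = 0"
    by (simp_all add: complex_eq_iff flip: of_real_power)
  define q where "q = 1 - 2 * \<rho> * cos \<theta> + \<rho>\<^sup>2"
  have q: "q = (1 - \<rho> * cos \<theta>)\<^sup>2 + (\<rho> * sin \<theta>)\<^sup>2"
  proof -
    have "(\<rho> * sin \<theta>)\<^sup>2 = \<rho>\<^sup>2 * (1 - (cos \<theta>)\<^sup>2)" by (simp add: power_mult_distrib sin_squared_eq)
    then show ?thesis by (simp add: q_def power2_eq_square algebra_simps)
  qed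
  \<comment> \<open>\<open>D\<close> is eliminated from the real and imaginary parts in
    \<open>eqs\<close>.\<close>
  have "C * q = (1 - \<rho> * cos \<theta>) * ((1 - \<rho> * cos \<theta>) * C + \<rho> * sin \<theta> * D)
      - \<rho> * sin \<theta> * ((1 - \<rho> * cos \<theta>) * D - \<rho> * sin \<theta> * C)"
    unfolding q by (simp add: power2_eq_square algebra_simps)
  then have Cq: "C * q = (1 - \<rho> ^ M) * (1 - \<rho> * cos \<theta>)" unfolding eqs by simp
  have "\<rho> * cos \<theta> \<le> \<rho>" using assms(1) by (simp add: mult_left_le)
  then have "1 - \<rho> * cos \<theta> > 0" using assms(2) by linarith
  then have qpos: "q > 0" unfolding q by (simp add: add_pos_nonneg)
  have Mpos: "1 - \<rho> ^ M > 0" using assms by (simp add: power_less_one_iff)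
  have "2 / (1 - \<rho> ^ M) * C - 1 = (2 * (1 - \<rho> * cos \<theta>) - q) / q"
    using Cq qpos Mpos by (simp add: field_simps)
  also have "2 * (1 - \<rho> * cos \<theta>) - q = 1 - \<rho>\<^sup>2" by (simp add: q_def)
  finally show ?thesis unfolding C_def q_def by simp
qed

text \<open>Squared modulus of the Dirichlet kernel: a Fejer kernel, whose Fourier coefficients are nonnegative.\<close>
definition fejer :: "nat \<Rightarrow> real \<Rightarrow> real" where
  "fejer b \<theta> = (cmod (\<Sum>u<b. cis (real u * \<theta>)))\<^sup>2"

lemma fejer_expand:
  "complex_of_real (fejer b \<theta>) = (\<Sum>u<b. \<Sum>v<b. cis (of_int (int u - int v) * \<theta>))"
  unfolding fejer_def complex_norm_square
  by (simp add: cnj_sum cis_cnj sum_product cis_mult left_diff_distrib)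

lemma trig_poly_fejer:
  assumes "0 < b"
  shows "trig_poly (b - 1) (\<lambda>\<theta>. of_real (fejer b \<theta>))"
  unfolding fejer_expand by (intro trig_poly_sum trig_poly_cis) (use assms in auto)

text \<open>Differences of frequencies are smaller than \<open>M\<close> in modulus, so only the
  \<open>b\<close> diagonal terms survive the summation.\<close>

lemma sum_fejer:
  assumes "0 < b" "b \<le> M"
  shows "(\<Sum>j<M. fejer b (2 * pi * real j / real M)) = real M * real b"
proof -
  define t where "t j = 2 * pi * real j / real M" for j
  have M: "0 < M" using assms by simp
  have "complex_of_real (\<Sum>j<M. fejer b (t j)) = (\<Sum>u<b. \<Sum>v<b. \<Sum>j<M. cis (of_int (int u - int v) * t j))"
    unfolding of_real_sum fejer_expand
    by (subst sum.swap) (rule sum.cong[OF refl], rule sum.swap)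
  also have "\<dots> = (\<Sum>u<b. \<Sum>v<b. if u = v then of_nat M else 0)"
  proof (intro sum.cong refl)
    fix u v assume "u \<in> {..<b}" "v \<in> {..<b}"
    then have lt: "\<bar>int u - int v\<bar> < int M" using assms by auto
    have "int M dvd int u - int v \<longleftrightarrow> u = v"
      using lt dvd_imp_le_int[of "int u - int v" "int M"] by auto
    then show "(\<Sum>j<M. cis (of_int (int u - int v) * t j)) = (if u = v then of_nat M else 0)"
      unfolding t_def sum_roots_of_unity[OF M] by simp
  qed
  also have "\<dots> = of_real (real M * real b)" by simp
  finally show ?thesis unfolding of_real_eq_iff t_def .
qed

text \<open>The alternating sign has frequency \<open>2 * b\<close> on these points. Expanding the
  Poisson kernel in cosines with positive weights \<rho>^k leaves only nonnegative character sums,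
  and each of the \<open>b * b\<close> frequency pairs of the Fejer kernel resonates with some k of
  at most \<open>3 * b\<close>.\<close>

lemma alternating_poisson_bound:
  assumes b: "0 < b" and \<rho>: "0 < \<rho>" "\<rho> < 1"
  defines "t \<equiv> \<lambda>j. 2 * pi * real j / real (4 * b)"
  shows "8 * real b ^ 3 * \<rho> ^ (3 * b)
    \<le> (\<Sum>j<4 * b. (-1) ^ j * fejer b (t j) * ((1 - \<rho>\<^sup>2) / (1 - 2 * \<rho> * cos (t j) + \<rho>\<^sup>2)))"
proof -
  define M where "M = 4 * b"
  have M: "0 < M" using b by (simp add: M_def)
  \<comment> \<open>\<open>B k\<close> pairs the signed Fejer weights with the k-th cosine.
    \<open>N u v k\<close> is the share of one frequency pair, nonzero only when the total frequency
    is a multiple of \<open>M\<close>.\<close>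
  define B where "B k = (\<Sum>j<M. (-1) ^ j * fejer b (t j) * cos (real k * t j))" for k
  define N where "N u v k = (if int M dvd int (2 * b) + int u - int v + int k then real M else 0)" for u v k
  have B: "B k = (\<Sum>u<b. \<Sum>v<b. N u v k)" for k
  proof -
    have sgn: "(-1) ^ j = cis (of_int (int (2 * b)) * t j)" for j
      using b by (simp add: t_def cis_half_turns[symmetric])
    have "(\<Sum>j<M. (-1) ^ j * complex_of_real (fejer b (t j)) * cis (real k * t j))
      = (\<Sum>j<M. \<Sum>u<b. \<Sum>v<b. cis (of_int (int (2 * b) + int u - int v + int k) * t j))"
      unfolding sgn fejer_expand sum_distrib_left sum_distrib_right
      by (intro sum.cong refl) (simp add: cis_mult algebra_simps)
    also have "\<dots> = (\<Sum>u<b. \<Sum>v<b. \<Sum>j<M. cis (of_int (int (2 * b) + int u - int v + int k) * t j))"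
      by (subst sum.swap) (rule sum.cong[OF refl], rule sum.swap)
    also have "\<dots> = of_real (\<Sum>u<b. \<Sum>v<b. N u v k)"
      unfolding of_real_sum N_def t_def M_def[symmetric] sum_roots_of_unity[OF M]
      by (intro sum.cong refl) simp
    finally have "Re (\<Sum>j<M. (-1) ^ j * complex_of_real (fejer b (t j)) * cis (real k * t j))
        = (\<Sum>u<b. \<Sum>v<b. N u v k)" by simp
    moreover have "Re ((-1) ^ j * complex_of_real x * z) = (-1) ^ j * x * Re z" for j x z
    proof -
      have "(-1) ^ j * complex_of_real x * z = of_real ((-1) ^ j * x) * z" by simp
      also have "Re \<dots> = (-1) ^ j * x * Re z" by (simp only: times_complex.simps Re_complex_of_real Im_complex_of_real)
      finally show ?thesis .
    qed
    ultimately show ?thesis unfolding B_def Re_sum by simp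
  qed
  have "real b * real b * (real M * \<rho> ^ (3 * b)) = (\<Sum>u<b. \<Sum>v<b. real M * \<rho> ^ (3 * b))" by simp
  also have "\<dots> \<le> (\<Sum>u<b. \<Sum>v<b. \<Sum>k<M. \<rho> ^ k * N u v k)"
  proof (intro sum_mono)
    fix u v assume uv: "u \<in> {..<b}" "v \<in> {..<b}"
    \<comment> \<open>This \<open>k\<close> brings the total frequency to exactly
      \<open>M\<close>.\<close>
    define k where "k = 2 * b + v - u"
    have k: "k < M" "k \<le> 3 * b" using uv by (auto simp: k_def M_def)
    have "int (2 * b) + int u - int v + int k = int M" using uv by (auto simp: k_def M_def)
    then have "N u v k = real M" unfolding N_def by simp
    then have "real M * \<rho> ^ (3 * b) \<le> \<rho> ^ k * N u v k"
      using k(2) \<rho> by (simp add: mult.commute mult_left_mono power_decreasing)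
    also have "\<dots> \<le> (\<Sum>k<M. \<rho> ^ k * N u v k)"
      using k(1) \<rho> by (intro member_le_sum) (auto simp: N_def)
    finally show "real M * \<rho> ^ (3 * b) \<le> (\<Sum>k<M. \<rho> ^ k * N u v k)" .
  qed
  also have "\<dots> = (\<Sum>k<M. \<rho> ^ k * B k)"
    unfolding B sum_distrib_left by (subst (2) sum.swap, subst sum.swap) (rule sum.cong[OF refl], rule refl)
  finally have low: "real b * real b * (real M * \<rho> ^ (3 * b)) \<le> (\<Sum>k<M. \<rho> ^ k * B k)" .
  have alt0: "(\<Sum>j<M. (-1) ^ j * fejer b (t j)) = 0"
  proof -
    have "(\<Sum>j<2 * (2 * b). (-1) ^ j * complex_of_real (fejer b (2 * pi * real j / real (2 * (2 * b))))) = 0"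
      using b by (intro trig_poly_alternating_sum[OF trig_poly_fejer]) auto
    then have "complex_of_real (\<Sum>j<M. (-1) ^ j * fejer b (t j)) = 0" by (simp add: M_def t_def)
    then show ?thesis by (simp only: of_real_eq_0_iff)
  qed
  have root: "cis (t j) ^ M = 1" for j
  proof -
    have "real M * t j = 2 * pi * real j" using b by (simp add: t_def M_def)
    then have "cis (t j) ^ M = cis (2 * pi * real j)" by (simp only: DeMoivre)
    also have "\<dots> = 1" by (rule cis_multiple_2pi) auto
    finally show ?thesis .
  qed
  \<comment> \<open>The prefactor of the folded Poisson series; \<open>alt0\<close> removes the
    constant -1 of that formula.\<close>
  define c where "c = 2 / (1 - \<rho> ^ M)"
  have c: "2 \<le> c" using \<rho> M unfolding c_def by (simp add: power_less_one_iff field_simps)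
  have "(\<Sum>j<M. (-1) ^ j * fejer b (t j) * ((1 - \<rho>\<^sup>2) / (1 - 2 * \<rho> * cos (t j) + \<rho>\<^sup>2)))
     = (\<Sum>j<M. c * (\<Sum>k<M. \<rho> ^ k * ((-1) ^ j * fejer b (t j) * cos (real k * t j))) - (-1) ^ j * fejer b (t j))"
    unfolding poisson_kernel_at_root[OF \<rho> M root] c_def[symmetric]
    by (intro sum.cong refl) (simp add: sum_distrib_left algebra_simps)
  also have "\<dots> = c * (\<Sum>k<M. \<rho> ^ k * B k)"
    unfolding sum_subtractf alt0 sum_distrib_left[symmetric] B_def
    by (subst sum.swap) (simp add: sum_distrib_left)
  also have "\<dots> \<ge> 2 * (\<Sum>k<M. \<rho> ^ k * B k)"
  proof (rule mult_right_mono[OF c])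
    have "0 \<le> real b * real b * (real M * \<rho> ^ (3 * b))" using \<rho> by simp
    with low show "0 \<le> (\<Sum>k<M. \<rho> ^ k * B k)" by linarith
  qed
  finally have "2 * (\<Sum>k<M. \<rho> ^ k * B k)
      \<le> (\<Sum>j<M. (-1) ^ j * fejer b (t j) * ((1 - \<rho>\<^sup>2) / (1 - 2 * \<rho> * cos (t j) + \<rho>\<^sup>2)))" .
  moreover have "8 * real b ^ 3 * \<rho> ^ (3 * b) = 2 * (real b * real b * (real M * \<rho> ^ (3 * b)))"
    by (simp add: M_def power3_eq_cube)
  ultimately show ?thesis using low unfolding M_def by linarith
qed

text \<open>The weights alternate in sign on the points \<open>|1 - \<rho> e\<^sup>i\<^sup>\<theta>|\<^sup>2 / (1 - \<rho>)\<^sup>2\<close> for \<open>\<theta>\<close> in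
  the \<open>4b\<close>-th roots of unity, times a Fejer kernel that concentrates them near 1. Dividing by the
  point makes the zeroth moment nonzero; an atom at 0 repairs it.\<close>
lemma moment_matching:
  assumes b: "0 < b" and \<rho>: "0 < \<rho>" "\<rho> < 1"
  obtains w0 w1 X :: "nat \<Rightarrow> real" and \<kappa> \<gamma> :: real where
    "\<forall>i. 0 \<le> w0 i \<and> 0 \<le> w1 i"
    "(\<Sum>i\<le>4 * b. w0 i) = 1" "(\<Sum>i\<le>4 * b. w1 i) = 1"
    "\<forall>i. X i = 0 \<or> 1 \<le> X i \<and> X i \<le> ((1 + \<rho>) / (1 - \<rho>))\<^sup>2"
    "\<forall>q\<le>Suc b. (\<Sum>i\<le>4 * b. (w1 i - w0 i) * X i ^ q) = 0"
    "\<forall>i. X i = 0 \<longrightarrow> w1 i = 0"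
    "(\<Sum>i\<le>4 * b. w1 i * X i) = \<kappa>"
    "(\<Sum>i\<le>4 * b. if X i = 0 then w0 i else 0) = \<gamma>"
    "\<kappa> * (2 * real b * (1 - \<rho>) * \<rho> ^ (3 * b)) \<le> \<gamma>"
proof -
  define M where "M = 4 * b"
  define t where "t j = 2 * pi * real j / real (4 * b)" for j
  define x where "x \<theta> = (1 - 2 * \<rho> * cos \<theta> + \<rho>\<^sup>2) / (1 - \<rho>)\<^sup>2" for \<theta>
  define g where "g j = fejer b (t j)" for j
  have g0: "0 \<le> g j" for j by (simp add: g_def fejer_def)
  have x: "1 \<le> x \<theta>" "x \<theta> \<le> ((1 + \<rho>) / (1 - \<rho>))\<^sup>2" for \<theta>
  proof -
    have "\<rho> * cos \<theta> \<le> \<rho>" "- \<rho> \<le> \<rho> * cos \<theta>"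
      using \<rho> cos_ge_minus_one[of \<theta>] mult_left_mono[of "-1" "cos \<theta>" \<rho>] by (auto simp: mult_left_le)
    then have "(1 - \<rho>)\<^sup>2 \<le> 1 - 2 * \<rho> * cos \<theta> + \<rho>\<^sup>2" "1 - 2 * \<rho> * cos \<theta> + \<rho>\<^sup>2 \<le> (1 + \<rho>)\<^sup>2"
      by (simp_all add: power2_eq_square algebra_simps)
    then show "1 \<le> x \<theta>" "x \<theta> \<le> ((1 + \<rho>) / (1 - \<rho>))\<^sup>2"
      using \<rho> by (simp_all add: x_def power_divide divide_right_mono)
  qed
  have tx: "trig_poly 1 (\<lambda>\<theta>. of_real (x \<theta>))"
  proof -
    have "trig_poly 1 (\<lambda>\<theta>. of_real ((1 + \<rho>\<^sup>2) / (1 - \<rho>)\<^sup>2) + of_real ((- 2 * \<rho> / (1 - \<rho>)\<^sup>2) * cos \<theta>))"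
      by (intro trig_poly_add trig_poly_const trig_poly_cos)
    moreover have "of_real ((1 + \<rho>\<^sup>2) / (1 - \<rho>)\<^sup>2) + of_real ((- 2 * \<rho> / (1 - \<rho>)\<^sup>2) * cos \<theta>) = complex_of_real (x \<theta>)" for \<theta>
      unfolding of_real_add[symmetric] x_def by (simp add: diff_divide_distrib add_divide_distrib)
    ultimately show ?thesis by simp
  qed
  \<comment> \<open>The Fejer kernel has degree \<open>b - 1\<close> and \<open>x\<close> has degree
    1, so for \<open>q\<close> up to \<open>b\<close> the product stays below \<open>2 * b\<close>,
    the frequency of the signs.\<close>
  have alt: "(\<Sum>j<M. (-1) ^ j * g j * x (t j) ^ q) = 0" if "q \<le> b" for q
  proof -
    have "trig_poly (b - 1 + q * 1) (\<lambda>\<theta>. of_real (fejer b \<theta>) * of_real (x \<theta>) ^ q)"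
      by (intro trig_poly_mult trig_poly_fejer trig_poly_power tx b)
    then have "(\<Sum>j<2 * (2 * b). (-1) ^ j * (complex_of_real (fejer b (2 * pi * real j / real (2 * (2 * b))))
        * of_real (x (2 * pi * real j / real (2 * (2 * b)))) ^ q)) = 0"
      by (rule trig_poly_alternating_sum) (use b that in simp)
    then have "complex_of_real (\<Sum>j<M. (-1) ^ j * g j * x (t j) ^ q) = 0"
      by (simp add: M_def t_def g_def mult.assoc)
    then show ?thesis by (simp only: of_real_eq_0_iff)
  qed
  define G where "G = (\<Sum>j<M. (-1) ^ j * (g j / x (t j)))"
  have G: "8 * real b ^ 3 * \<rho> ^ (3 * b) * ((1 - \<rho>) / (1 + \<rho>)) \<le> G"
  proof -
    \<comment> \<open>The reciprocal of \<open>x\<close> is a multiple of the Poisson kernel, so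
      \<open>alternating_poisson_bound\<close> controls the defect \<open>G\<close> of the zeroth
      moment.\<close>
    have "(1 - \<rho>\<^sup>2) / (1 - 2 * \<rho> * cos \<theta> + \<rho>\<^sup>2) * ((1 - \<rho>) / (1 + \<rho>)) = 1 / x \<theta>" for \<theta>
    proof -
      have "x \<theta> \<noteq> 0" using x(1)[of \<theta>] by auto
      then have "1 - 2 * \<rho> * cos \<theta> + \<rho>\<^sup>2 \<noteq> 0" by (auto simp: x_def)
      moreover have "1 - \<rho>\<^sup>2 = (1 - \<rho>) * (1 + \<rho>)" by (simp add: power2_eq_square algebra_simps)
      ultimately show ?thesis using \<rho> by (simp add: x_def power2_eq_square)
    qed
    note K = this
    have "G = (\<Sum>j<M. (-1) ^ j * fejer b (t j) * ((1 - \<rho>\<^sup>2) / (1 - 2 * \<rho> * cos (t j) + \<rho>\<^sup>2)))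
        * ((1 - \<rho>) / (1 + \<rho>))"
      unfolding G_def sum_distrib_right
    proof (intro sum.cong refl)
      fix j
      have "g j / x (t j) = fejer b (t j) * (1 / x (t j))" by (simp add: g_def)
      then show "(-1) ^ j * (g j / x (t j)) = (-1) ^ j * fejer b (t j) *
          ((1 - \<rho>\<^sup>2) / (1 - 2 * \<rho> * cos (t j) + \<rho>\<^sup>2)) * ((1 - \<rho>) / (1 + \<rho>))"
        unfolding K[symmetric] by (simp only: mult.assoc)
    qed
    also have "\<dots> \<ge> 8 * real b ^ 3 * \<rho> ^ (3 * b) * ((1 - \<rho>) / (1 + \<rho>))"
      using alternating_poisson_bound[OF b \<rho>] \<rho> unfolding M_def t_def
      by (intro mult_right_mono) auto
    finally show ?thesis .
  qed
  then have G0: "0 \<le> G" using \<rho> by (intro order_trans[OF _ G]) simp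
  define A where "A = (\<Sum>j<M. if even j then g j / x (t j) else 0)"
  have x0: "0 < x \<theta>" for \<theta> using x(1)[of \<theta>] by linarith
  have "0 < A"
  proof -
    \<comment> \<open>Index 0 is the peak of the Fejer kernel, with value
      \<open>b * b\<close>.\<close>
    have "0 < g 0 / x (t 0)" using b x0 by (simp add: g_def t_def fejer_def)
    also have "\<dots> \<le> A" unfolding A_def
      using b g0 x0[THEN less_imp_le]
      by (intro member_le_sum[of 0 "{..<M}" "\<lambda>j. if even j then g j / x (t j) else 0", simplified]) (auto simp: M_def)
    finally show ?thesis .
  qed
  \<comment> \<open>The alternating sum vanishes, so the even points carry half of the total mass
    \<open>4 * b * b\<close>.\<close>
  have ev: "(\<Sum>j<M. if even j then g j else 0) = 2 * real b ^ 2"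
  proof -
    have "(\<Sum>j<M. if even j then g j else 0) = (\<Sum>j<M. (g j + (-1) ^ j * g j) / 2)"
      by (intro sum.cong refl) auto
    also have "\<dots> = ((\<Sum>j<M. g j) + (\<Sum>j<M. (-1) ^ j * g j)) / 2"
      by (simp add: sum.distrib flip: sum_divide_distrib)
    also have "\<dots> = 2 * real b ^ 2"
      using alt[of 0] sum_fejer[of b M] b by (simp add: M_def g_def t_def power2_eq_square)
    finally show ?thesis .
  qed
  \<comment> \<open>Even points go to \<open>w1\<close>, odd points to \<open>w0\<close>. Index
    \<open>M\<close> is the additional atom at 0, of mass \<open>G / A\<close>, which only
    \<open>w0\<close> has.\<close>
  define X where "X j = (if j < M then x (t j) else 0)" for j
  define w1 where "w1 j = (if j < M \<and> even j then g j / x (t j) / A else 0)" for j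
  define w0 where "w0 j = (if j < M \<and> odd j then g j / x (t j) / A else if j = M then G / A else 0)" for j
  have split: "(\<Sum>i\<le>4 * b. f i) = (\<Sum>i<M. f i) + f M" for f :: "nat \<Rightarrow> real"
    unfolding M_def by (simp add: lessThan_Suc_atMost[symmetric])
  have diff: "w1 j - w0 j = (-1) ^ j * (g j / x (t j)) / A" if "j < M" for j
    using that by (simp add: w0_def w1_def)
  have sum1: "(\<Sum>i\<le>4 * b. w1 i) = 1"
  proof -
    have "(\<Sum>i<M. w1 i) = (\<Sum>i<M. (if even i then g i / x (t i) else 0) / A)"
      by (intro sum.cong) (auto simp: w1_def)
    also have "\<dots> = 1" using \<open>0 < A\<close> by (simp add: A_def flip: sum_divide_distrib)
    finally show ?thesis by (simp add: split w1_def)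
  qed
  have mom: "(\<Sum>i\<le>4 * b. (w1 i - w0 i) * X i ^ q) = 0" if "q \<le> Suc b" for q
  proof (cases q)
    case 0
    have "(\<Sum>i<M. w1 i - w0 i) = G / A"
      unfolding G_def sum_divide_distrib by (intro sum.cong) (auto simp: diff)
    then show ?thesis by (simp add: 0 split w0_def w1_def)
  next
    \<comment> \<open>One factor \<open>x\<close> cancels the division by \<open>x\<close>, and the
      atom at 0 is invisible to positive powers. Hence the matching reaches \<open>Suc b\<close>,
      one degree beyond \<open>alt\<close>.\<close>
    case (Suc p)
    have "(\<Sum>i<M. (w1 i - w0 i) * X i ^ q) = (\<Sum>i<M. (-1) ^ i * g i * x (t i) ^ p / A)"
    proof (intro sum.cong refl)
      fix i assume "i \<in> {..<M}"
      then show "(w1 i - w0 i) * X i ^ q = (-1) ^ i * g i * x (t i) ^ p / A"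
        using x0[of "t i"] by (simp add: diff X_def Suc)
    qed
    also have "\<dots> = 0" using alt[of p] that Suc by (simp flip: sum_divide_distrib)
    finally show ?thesis by (simp add: split X_def Suc)
  qed
  show ?thesis
  proof (rule that[of w0 w1 X "2 * real b ^ 2 / A" "G / A"])
    show "\<forall>i. 0 \<le> w0 i \<and> 0 \<le> w1 i"
      using g0 x0[THEN less_imp_le] G0 \<open>0 < A\<close> by (auto simp: w0_def w1_def)
    show "(\<Sum>i\<le>4 * b. w1 i) = 1" by (rule sum1)
    show "(\<Sum>i\<le>4 * b. w0 i) = 1" using mom[of 0] sum1 by (simp add: sum_subtractf)
    show "\<forall>i. X i = 0 \<or> 1 \<le> X i \<and> X i \<le> ((1 + \<rho>) / (1 - \<rho>))\<^sup>2" by (simp add: X_def x)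
    show "\<forall>q\<le>Suc b. (\<Sum>i\<le>4 * b. (w1 i - w0 i) * X i ^ q) = 0" by (simp add: mom)
    show "\<forall>i. X i = 0 \<longrightarrow> w1 i = 0"
      using x0 by (simp add: X_def w1_def less_imp_neq[THEN not_sym])
    have "(\<Sum>i<M. w1 i * X i) = (\<Sum>i<M. (if even i then g i else 0) / A)"
    proof (intro sum.cong refl)
      fix i assume "i \<in> {..<M}"
      then show "w1 i * X i = (if even i then g i else 0) / A"
        using x0[of "t i"] by (simp add: w1_def X_def)
    qed
    also have "\<dots> = 2 * real b ^ 2 / A" by (simp add: ev flip: sum_divide_distrib)
    finally show "(\<Sum>i\<le>4 * b. w1 i * X i) = 2 * real b ^ 2 / A" by (simp add: split X_def)
    have "(\<Sum>i<M. if X i = 0 then w0 i else 0) = 0"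
    proof (intro sum.neutral ballI)
      fix i assume "i \<in> {..<M}"
      then show "(if X i = 0 then w0 i else 0) = 0" using x0[of "t i"] by (simp add: X_def)
    qed
    then show "(\<Sum>i\<le>4 * b. if X i = 0 then w0 i else 0) = G / A" by (simp add: split X_def w0_def)
    \<comment> \<open>The left side is \<kappa> A times the claimed ratio; 1 + \<rho> below 2 brings
      it under the lower bound \<open>G\<close>.\<close>
    have "2 * real b ^ 2 * (2 * real b * (1 - \<rho>) * \<rho> ^ (3 * b))
        = 8 * real b ^ 3 * \<rho> ^ (3 * b) * ((1 - \<rho>) / 2)"
      by (simp add: power2_eq_square power3_eq_cube)
    also have "\<dots> \<le> 8 * real b ^ 3 * \<rho> ^ (3 * b) * ((1 - \<rho>) / (1 + \<rho>))"
      using \<rho> by (intro mult_left_mono divide_left_mono) auto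
    finally show "2 * real b ^ 2 / A * (2 * real b * (1 - \<rho>) * \<rho> ^ (3 * b)) \<le> G / A"
      using G \<open>0 < A\<close> by (simp add: divide_right_mono)
  qed
qed

section \<open>Exchanging the priors\<close>

text \<open>Expectation under independent coordinates when each \<open>W i\<close> is a probability
  vector. The weights may depend on the coordinate, as hybrids of two priors require.\<close>

definition prod_expect ::
    "nat set \<Rightarrow> 'l set \<Rightarrow> (nat \<Rightarrow> 'l \<Rightarrow> real) \<Rightarrow> ((nat \<Rightarrow> 'l) \<Rightarrow> real) \<Rightarrow> real" where
  "prod_expect A J W F = (\<Sum>f\<in>A \<rightarrow>\<^sub>E J. (\<Prod>i\<in>A. W i (f i)) * F f)"

lemma prod_expect_prod:
  assumes "finite A" "finite J"
  shows "prod_expect A J W (\<lambda>f. \<Prod>i\<in>A. h i (f i)) = (\<Prod>i\<in>A. \<Sum>l\<in>J. W i l * h i l)"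
  using assms by (simp add: prod_expect_def prod_sum_PiE prod.distrib)

lemma prod_expect_const:
  assumes "finite A" "finite J" "\<And>i. i \<in> A \<Longrightarrow> (\<Sum>l\<in>J. W i l) = 1"
  shows "prod_expect A J W (\<lambda>_. c) = c"
  using prod_expect_prod[OF assms(1,2), of W "\<lambda>_ _. 1"] assms(3)
  by (simp add: prod_expect_def sum_distrib_right[symmetric])

lemma prod_expect_add:
  "prod_expect A J W (\<lambda>f. F f + G f) = prod_expect A J W F + prod_expect A J W G"
  by (simp add: prod_expect_def sum.distrib distrib_left)

lemma prod_expect_cmult:
  "prod_expect A J W (\<lambda>f. c * F f) = c * prod_expect A J W F"
  by (simp add: prod_expect_def sum_distrib_left mult_ac)

text \<open>The comparison is asked only where the weight is nonzero, so labels that a prior never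
  draws can be ignored.\<close>

lemma prod_expect_mono:
  assumes "\<And>i l. i \<in> A \<Longrightarrow> l \<in> J \<Longrightarrow> 0 \<le> W i l"
    and "\<And>f. f \<in> A \<rightarrow>\<^sub>E J \<Longrightarrow> (\<Prod>i\<in>A. W i (f i)) \<noteq> 0 \<Longrightarrow> F f \<le> G f"
  shows "prod_expect A J W F \<le> prod_expect A J W G"
  unfolding prod_expect_def
proof (intro sum_mono)
  fix f assume f: "f \<in> A \<rightarrow>\<^sub>E J"
  then have "0 \<le> (\<Prod>i\<in>A. W i (f i))" by (intro prod_nonneg) (auto intro!: assms(1))
  then show "(\<Prod>i\<in>A. W i (f i)) * F f \<le> (\<Prod>i\<in>A. W i (f i)) * G f"
    using assms(2)[OF f] by (cases "(\<Prod>i\<in>A. W i (f i)) = 0") (auto intro: mult_left_mono)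
qed

text \<open>Fubini for a single coordinate; it isolates the one in which two neighbouring hybrids
  differ.\<close>

lemma prod_expect_insert:
  assumes "finite A" "t \<notin> A"
  shows "prod_expect (insert t A) J W F
       = prod_expect A J W (\<lambda>g. \<Sum>l\<in>J. W t l * F (g(t := l)))"
proof -
  have "prod_expect (insert t A) J W F
      = (\<Sum>(l, g)\<in>J \<times> (A \<rightarrow>\<^sub>E J). (\<Prod>i\<in>insert t A. W i ((g(t := l)) i)) * F (g(t := l)))"
    unfolding prod_expect_def PiE_insert_eq
    by (subst sum.reindex[OF inj_combinator[OF assms(2)]]) (simp add: case_prod_unfold o_def)
  also have "\<dots> = (\<Sum>g\<in>A \<rightarrow>\<^sub>E J. \<Sum>l\<in>J. (\<Prod>i\<in>insert t A. W i ((g(t := l)) i)) * F (g(t := l)))"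
    by (subst sum.cartesian_product[symmetric]) (rule sum.swap)
  also have "\<dots> = prod_expect A J W (\<lambda>g. \<Sum>l\<in>J. W t l * F (g(t := l)))"
    unfolding prod_expect_def sum_distrib_left
  proof (intro sum.cong refl)
    fix g l
    have "(\<Prod>i\<in>insert t A. W i ((g(t := l)) i)) = W t l * (\<Prod>i\<in>A. W i (g i))"
      using assms by (auto intro!: prod.cong)
    then show "(\<Prod>i\<in>insert t A. W i ((g(t := l)) i)) * F (g(t := l))
        = (\<Prod>i\<in>A. W i (g i)) * (W t l * F (g(t := l)))" by simp
  qed
  finally show ?thesis .
qed

lemma abs_prod_expect_le:
  assumes "\<And>i l. i \<in> A \<Longrightarrow> l \<in> J \<Longrightarrow> 0 \<le> W i l"
    and "\<And>f. f \<in> A \<rightarrow>\<^sub>E J \<Longrightarrow> \<bar>F f\<bar> \<le> G f"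
  shows "\<bar>prod_expect A J W F\<bar> \<le> prod_expect A J W G"
proof -
  have "\<bar>prod_expect A J W F\<bar> \<le> (\<Sum>f\<in>A \<rightarrow>\<^sub>E J. \<bar>(\<Prod>i\<in>A. W i (f i)) * F f\<bar>)"
    unfolding prod_expect_def by (rule sum_abs)
  also have "\<dots> \<le> (\<Sum>f\<in>A \<rightarrow>\<^sub>E J. (\<Prod>i\<in>A. W i (f i)) * G f)"
  proof (intro sum_mono)
    fix f assume f: "f \<in> A \<rightarrow>\<^sub>E J"
    then have "0 \<le> (\<Prod>i\<in>A. W i (f i))" by (intro prod_nonneg) (auto intro!: assms(1))
    then show "\<bar>(\<Prod>i\<in>A. W i (f i)) * F f\<bar> \<le> (\<Prod>i\<in>A. W i (f i)) * G f"
      unfolding abs_mult using assms(2)[OF f] by (intro mult_mono) auto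
  qed
  finally show ?thesis unfolding prod_expect_def .
qed

text \<open>Hybrid argument: the coordinates are switched from \<open>w0\<close> to \<open>w1\<close> one at a time.\<close>
lemma hybrid_bound:
  fixes w0 w1 h :: "'l \<Rightarrow> real"
  assumes J: "finite J"
    and w0: "\<And>l. l \<in> J \<Longrightarrow> 0 \<le> w0 l" "(\<Sum>l\<in>J. w0 l) = 1"
    and w1: "\<And>l. l \<in> J \<Longrightarrow> 0 \<le> w1 l" "(\<Sum>l\<in>J. w1 l) = 1"
    and h: "\<And>l. l \<in> J \<Longrightarrow> 0 \<le> h l" "(\<Sum>l\<in>J. w0 l * h l) \<le> B" "(\<Sum>l\<in>J. w1 l * h l) \<le> B"
    and B: "1 \<le> B" and c: "0 \<le> c"
    and step: "\<And>t g. t < n \<Longrightarrow> g \<in> ({..<n} - {t}) \<rightarrow>\<^sub>E J \<Longrightarrow>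
        \<bar>\<Sum>l\<in>J. (w1 l - w0 l) * F (g(t := l))\<bar> \<le> e + c * (\<Prod>i\<in>{..<n} - {t}. h (g i))"
  shows "\<bar>prod_expect {..<n} J (\<lambda>_. w1) F - prod_expect {..<n} J (\<lambda>_. w0) F\<bar> \<le> real n * (e + c * B ^ n)"
proof -
  \<comment> \<open>Hybrid \<open>t\<close> draws the coordinates below \<open>t\<close> from
    \<open>w1\<close> and the others from \<open>w0\<close>.\<close>
  define W where "W t i = (if i < t then w1 else w0)" for t i :: nat
  define H where "H t = prod_expect {..<n} J (W t) F" for t
  have W: "0 \<le> W t i l" "(\<Sum>l\<in>J. W t i l) = 1" "0 \<le> (\<Sum>l\<in>J. W t i l * h l)"
    "(\<Sum>l\<in>J. W t i l * h l) \<le> B" if "l \<in> J" for t i l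
    using w0 w1 h that by (auto simp: W_def intro!: sum_nonneg)
  have diff: "\<bar>H (Suc t) - H t\<bar> \<le> e + c * B ^ n" if t: "t < n" for t
  proof (cases "J = {}")
    case True
    then show ?thesis using w0(2) by simp
  next
    case False
    then obtain l0 where l0: "l0 \<in> J" by auto
    define A where "A = {..<n} - {t}"
    have A: "finite A" "t \<notin> A" "{..<n} = insert t A" using t by (auto simp: A_def)
    have same: "prod_expect A J (W (Suc t)) G = prod_expect A J (W t) G" for G
      unfolding prod_expect_def
      by (intro sum.cong refl arg_cong2[where f = "(*)"] prod.cong) (auto simp: W_def A_def less_Suc_eq)
    have "H (Suc t) - H t = prod_expect A J (W t) (\<lambda>g. \<Sum>l\<in>J. w1 l * F (g(t := l)))
        - prod_expect A J (W t) (\<lambda>g. \<Sum>l\<in>J. w0 l * F (g(t := l)))"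
      unfolding H_def A(3) prod_expect_insert[OF A(1,2)] same by (simp add: W_def)
    also have "\<dots> = prod_expect A J (W t) (\<lambda>g. \<Sum>l\<in>J. (w1 l - w0 l) * F (g(t := l)))"
      by (simp add: prod_expect_def left_diff_distrib right_diff_distrib sum_subtractf)
    finally have "\<bar>H (Suc t) - H t\<bar> \<le> prod_expect A J (W t) (\<lambda>g. e + c * (\<Prod>i\<in>A. h (g i)))"
      using step[OF t] W(1) by (auto simp: A_def intro!: abs_prod_expect_le)
    also have "\<dots> = e + c * (\<Prod>i\<in>A. \<Sum>l\<in>J. W t i l * h l)"
      unfolding prod_expect_add prod_expect_cmult prod_expect_prod[OF A(1) J, of "W t" "\<lambda>_. h"]
      using prod_expect_const[OF A(1) J, of "W t" e] W(2)[OF l0] by simp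
    \<comment> \<open>Only \<open>n - 1\<close> factors remain; \<open>1 \<le> B\<close> lets the
      exponent be rounded up to \<open>n\<close>.\<close>
    also have "\<dots> \<le> e + c * B ^ n"
    proof -
      have "(\<Prod>i\<in>A. \<Sum>l\<in>J. W t i l * h l) \<le> (\<Prod>i\<in>A. B)"
        using W(3,4)[OF l0] by (intro prod_mono) auto
      also have "\<dots> \<le> B ^ n" using B t by (simp add: A_def power_increasing)
      finally show ?thesis using c by (simp add: mult_left_mono)
    qed
    finally show ?thesis .
  qed
  have "H n - H 0 = (\<Sum>t<n. H (Suc t) - H t)" by (rule sum_lessThan_telescope[symmetric])
  then have "\<bar>H n - H 0\<bar> \<le> (\<Sum>t<n. e + c * B ^ n)"
    using diff by (simp only:) (intro order_trans[OF sum_abs] sum_mono, auto)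
  moreover have "H n = prod_expect {..<n} J (\<lambda>_. w1) F"
    unfolding H_def prod_expect_def W_def
    by (intro sum.cong refl arg_cong2[where f = "(*)"] prod.cong) auto
  moreover have "H 0 = prod_expect {..<n} J (\<lambda>_. w0) F" by (simp add: H_def prod_expect_def W_def)
  ultimately show ?thesis by simp
qed

text \<open>A label \<open>(j, \<sigma>)\<close> stands for an outcome of probability \<open>y j\<close> and amplitude \<open>\<sigma> sqrt (y j)\<close>;
  outcome 0 takes the remaining probability, with sign \<open>\<tau>\<close>.\<close>
definition amplitude ::
    "(nat \<Rightarrow> real) \<Rightarrow> nat \<Rightarrow> real \<Rightarrow> (nat \<Rightarrow> nat \<times> real) \<Rightarrow> nat \<Rightarrow> real" where
  "amplitude y n \<tau> f i = (if i = 0 then \<tau> * sqrt (1 - (\<Sum>k<n. y (fst (f k))))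
     else snd (f (i - 1)) * sqrt (y (fst (f (i - 1)))))"

lemma sum_amplitude_squares:
  assumes "\<And>k. k < n \<Longrightarrow> 0 \<le> y (fst (f k)) \<and> \<bar>snd (f k)\<bar> = 1"
    and "(\<Sum>k<n. y (fst (f k))) \<le> 1" "\<bar>\<tau>\<bar> = 1"
  shows "(amplitude y n \<tau> f 0)\<^sup>2 = 1 - (\<Sum>k<n. y (fst (f k)))"
    "k < n \<Longrightarrow> (amplitude y n \<tau> f (Suc k))\<^sup>2 = y (fst (f k))"
    "(\<Sum>i<Suc n. (amplitude y n \<tau> f i)\<^sup>2) = 1"
proof -
  have sq: "s\<^sup>2 = 1" if "\<bar>s\<bar> = 1" for s :: real using that by (metis power2_abs power_one)
  show 0: "(amplitude y n \<tau> f 0)\<^sup>2 = 1 - (\<Sum>k<n. y (fst (f k)))"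
    using assms(2,3) by (simp add: amplitude_def power_mult_distrib sq)
  have k: "(amplitude y n \<tau> f (Suc k))\<^sup>2 = y (fst (f k))" if "k < n" for k
    using assms(1)[OF that] by (simp add: amplitude_def power_mult_distrib sq)
  then show "k < n \<Longrightarrow> (amplitude y n \<tau> f (Suc k))\<^sup>2 = y (fst (f k))" .
  show "(\<Sum>i<Suc n. (amplitude y n \<tau> f i)\<^sup>2) = 1"
    unfolding sum.lessThan_Suc_shift using 0 k by simp
qed

section \<open>Acceptance under random amplitudes\<close>

definition accept_prob :: "nat \<Rightarrow> qalg \<Rightarrow> (real \<Rightarrow> bool) \<Rightarrow> (nat \<Rightarrow> real) \<Rightarrow> real" where
  "accept_prob N A S v = prob_output N (Suc N) A (swap_oracle N v) S"

lemma accept_prob_bounds: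
  assumes "well_formed_alg (Suc n) (Suc (Suc n)) A" "(\<Sum>i<Suc n. (v i)\<^sup>2) = 1"
  shows "0 \<le> accept_prob (Suc n) A S v" "accept_prob (Suc n) A S v \<le> 1"
  unfolding accept_prob_def
  using prob_output_nonneg prob_output_le_1[OF assms(1) is_unitary_swap_oracle[OF assms(2)]] by auto

text \<open>Averaging over the sign of outcome 0, together with the random signs in the labels,
  realises the average over four angles. Independent draws may sum to more than 1 and then define no
  distribution; beyond total 1/2 the value is set to 0, and such draws are paid for by an
  exponential tail bound.\<close>

definition mean_accept ::
    "(nat \<Rightarrow> real) \<Rightarrow> nat \<Rightarrow> qalg \<Rightarrow> (real \<Rightarrow> bool) \<Rightarrow> (nat \<Rightarrow> nat \<times> real) \<Rightarrow> real" where
  "mean_accept y n A S f = (if (\<Sum>k<n. y (fst (f k))) \<le> 1 / 2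
     then (accept_prob (Suc n) A S (amplitude y n 1 f) + accept_prob (Suc n) A S (amplitude y n (-1) f)) / 2
     else 0)"

lemma mean_accept_bounds:
  assumes A: "well_formed_alg (Suc n) (Suc (Suc n)) A"
    and f: "\<And>k. k < n \<Longrightarrow> 0 \<le> y (fst (f k)) \<and> \<bar>snd (f k)\<bar> = 1"
  shows "0 \<le> mean_accept y n A S f" "mean_accept y n A S f \<le> 1"
proof -
  have "0 \<le> accept_prob (Suc n) A S (amplitude y n \<tau> f) \<and> accept_prob (Suc n) A S (amplitude y n \<tau> f) \<le> 1"
    if "(\<Sum>k<n. y (fst (f k))) \<le> 1 / 2" "\<bar>\<tau>\<bar> = 1" for \<tau>
    using accept_prob_bounds[OF A sum_amplitude_squares(3)[of n y f \<tau>]] f that by simp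
  from this[of 1] this[of "-1"]
  show "0 \<le> mean_accept y n A S f" "mean_accept y n A S f \<le> 1" by (auto simp: mean_accept_def)
qed

lemma sum_signs: "(\<Sum>l\<in>I \<times> {1, - 1 :: real}. f l) = (\<Sum>j\<in>I. f (j, 1) + f (j, - 1))"
  by (simp add: sum.cartesian_product[symmetric, of "\<lambda>a b. f (a, b)", simplified])

text \<open>Replacing one coordinate rotates the amplitudes of two outcomes, so the acceptance
  probability is a trigonometric polynomial in the angle of rotation.\<close>
lemma mean_accept_step:
  fixes I :: "nat set" and y w0 w1 :: "nat \<Rightarrow> real"
  assumes A: "well_formed_alg (Suc n) (Suc (Suc n)) A" and I: "finite I"
    and y: "\<And>j. j \<in> I \<Longrightarrow> 0 \<le> y j" "\<And>j. j \<in> I \<Longrightarrow> y j \<le> 1 / 8"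
      "\<And>j. j \<in> I \<Longrightarrow> 2 * y j \<le> Z"
    and Z: "0 \<le> Z"
    and mass: "(\<Sum>j\<in>I. \<bar>w1 j - w0 j\<bar>) \<le> 2"
    and moments: "\<And>q. q \<le> m \<Longrightarrow> (\<Sum>j\<in>I. (w1 j - w0 j) * y j ^ q) = 0"
    and t: "t < n" and g: "g \<in> ({..<n} - {t}) \<rightarrow>\<^sub>E I \<times> {1, - 1 :: real}"
    and s: "0 \<le> s"
  defines "K \<equiv> 4 * nqueries A"
  shows "\<bar>\<Sum>l\<in>I \<times> {1, - 1}. (w1 (fst l) / 2 - w0 (fst l) / 2) * mean_accept y n A S (g(t := l))\<bar>
      \<le> 2 * real (2 * K + 1) * (\<Sum>j\<in>{m<..K}. (2 * real K) ^ (2 * j) * Z ^ j / fact (2 * j))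
        + 2 * exp (- 3 * s / 8) * (\<Prod>i\<in>{..<n} - {t}. exp (s * y (fst (g i))))"
proof -
  define E where "E = 2 * real (2 * K + 1) * (\<Sum>j\<in>{m<..K}. (2 * real K) ^ (2 * j) * Z ^ j / fact (2 * j))"
  define O' where "O' = (\<Sum>i\<in>{..<n} - {t}. y (fst (g i)))"
  have E0: "0 \<le> E" using Z by (simp add: E_def sum_nonneg)
  have "exp (s * O' - 3 * s / 8) = exp (- 3 * s / 8) * exp (\<Sum>i\<in>{..<n} - {t}. s * y (fst (g i)))"
    by (simp add: O'_def sum_distrib_left exp_add[symmetric])
  then have expO: "exp (- 3 * s / 8) * (\<Prod>i\<in>{..<n} - {t}. exp (s * y (fst (g i)))) = exp (s * O' - 3 * s / 8)"
    by (simp add: exp_sum)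
  have gi: "fst (g i) \<in> I" "\<bar>snd (g i)\<bar> = 1" if "i \<in> {..<n} - {t}" for i
    using PiE_mem[OF g that] by auto
  have gl: "0 \<le> y (fst ((g(t := l)) k)) \<and> \<bar>snd ((g(t := l)) k)\<bar> = 1"
    if "l \<in> I \<times> {1, - 1}" "k < n" for l k
    using gi[of k] that y(1) by (cases "k = t") auto
  have total: "(\<Sum>k<n. y (fst ((g(t := l)) k))) = O' + y (fst l)" for l
  proof -
    have "(\<Sum>k<n. y (fst ((g(t := l)) k))) = y (fst l) + (\<Sum>k\<in>{..<n} - {t}. y (fst ((g(t := l)) k)))"
      using t by (subst sum.remove[of _ t]) auto
    also have "(\<Sum>k\<in>{..<n} - {t}. y (fst ((g(t := l)) k))) = O'"
      unfolding O'_def by (intro sum.cong) auto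
    finally show ?thesis by simp
  qed
  have O0: "0 \<le> O'" unfolding O'_def using gi y(1) by (intro sum_nonneg) auto
  \<comment> \<open>The threshold 3/8 plus a last coordinate of at most 1/8 stays within the cutoff
    1/2, so in the first case the cutoff is inactive for every label.\<close>
  show ?thesis
  proof (cases "O' \<le> 3 / 8")
    case True
    define R where "R = 1 - O'"
    have R: "5 / 8 \<le> R" "R \<le> 1" using True O0 by (auto simp: R_def)
    \<comment> \<open>Outcomes 0 and \<open>Suc t\<close> share the mass \<open>R\<close>, and the
      angle says how it is divided. All other amplitudes are fixed by \<open>g\<close>.\<close>
    define v where "v \<theta> i = (if i = 0 then sqrt R * cos \<theta> else if i = Suc t then sqrt R * sin \<theta>
        else snd (g (i - 1)) * sqrt (y (fst (g (i - 1)))))" for \<theta> i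
    define P where "P \<theta> = complex_of_real (accept_prob (Suc n) A S (v \<theta>))" for \<theta>
    have vt: "trig_poly 1 (\<lambda>\<theta>. of_real (v \<theta> i))" for i
      unfolding v_def by (cases "i = 0"; cases "i = Suc t")
        (simp_all only: if_True if_False trig_poly_const trig_poly_cos trig_poly_sin simp_thms)
    have Pt: "trig_poly K P"
      unfolding P_def accept_prob_def K_def by (rule trig_poly_prob_output[OF A vt])
    have v2: "(\<Sum>i<Suc n. (v \<theta> i)\<^sup>2) = 1" for \<theta>
    proof -
      have "(\<Sum>i<n. (v \<theta> (Suc i))\<^sup>2) = (v \<theta> (Suc t))\<^sup>2 + (\<Sum>i\<in>{..<n} - {t}. (v \<theta> (Suc i))\<^sup>2)"
        using t by (subst sum.remove[of _ t]) auto
      also have "(\<Sum>i\<in>{..<n} - {t}. (v \<theta> (Suc i))\<^sup>2) = O'"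
        unfolding O'_def
      proof (intro sum.cong refl)
        fix i assume i: "i \<in> {..<n} - {t}"
        have "(snd (g i))\<^sup>2 = 1" using gi(2)[OF i] by (metis power2_abs power_one)
        then show "(v \<theta> (Suc i))\<^sup>2 = y (fst (g i))"
          using i gi(1)[OF i] y(1) by (simp add: v_def power_mult_distrib)
      qed
      finally have "(\<Sum>i<Suc n. (v \<theta> i)\<^sup>2) = R * (cos \<theta>)\<^sup>2 + R * (sin \<theta>)\<^sup>2 + O'"
        unfolding sum.lessThan_Suc_shift using R by (simp add: v_def power_mult_distrib)
      also have "\<dots> = R * ((cos \<theta>)\<^sup>2 + (sin \<theta>)\<^sup>2) + O'" by (simp only: distrib_left)
      also have "\<dots> = 1" unfolding sin_cos_squared_add2 by (simp add: R_def)
      finally show ?thesis .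
    qed
    have P1: "cmod (P \<theta>) \<le> 1" for \<theta>
      using accept_prob_bounds[OF A v2[of \<theta>], of S] by (simp add: P_def)
    define \<theta> where "\<theta> j = arcsin (sqrt (y j / R))" for j
    \<comment> \<open>\<open>R\<close> exceeds 1/2, which is why the bound \<open>Z\<close>
      dominates \<open>2 * y j\<close>.\<close>
    have yR: "0 \<le> y j / R" "y j / R \<le> 1" "y j / R \<le> Z" if "j \<in> I" for j
    proof -
      show "0 \<le> y j / R" "y j / R \<le> 1" using y(1,2)[OF that] R by (auto simp: divide_le_eq)
      have "y j \<le> 2 * y j * R" using R y(1)[OF that] mult_left_mono[of 1 "2 * R" "y j"] by (simp add: mult_ac)
      also have "\<dots> \<le> Z * R" using y(3)[OF that] R by (intro mult_right_mono) auto
      finally show "y j / R \<le> Z" using R by (simp add: divide_le_eq)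
    qed
    have sin\<theta>: "sin (\<theta> j) = sqrt (y j / R)" and cos\<theta>: "cos (\<theta> j) = sqrt (1 - y j / R)" if "j \<in> I" for j
    proof -
      have "0 \<le> sqrt (y j / R)" "sqrt (y j / R) \<le> 1" using yR[OF that] by auto
      then have "-1 \<le> sqrt (y j / R)" "sqrt (y j / R) \<le> 1" by linarith+
      from sin_arcsin[OF this] cos_arcsin[OF this]
      show "sin (\<theta> j) = sqrt (y j / R)" "cos (\<theta> j) = sqrt (1 - y j / R)"
        unfolding \<theta>_def real_sqrt_pow2[OF yR(1)[OF that]] by auto
    qed
    have scaled: "sqrt R * sin (\<theta> j) = sqrt (y j)" "sqrt R * cos (\<theta> j) = sqrt (R - y j)" if "j \<in> I" for j
      using R unfolding sin\<theta>[OF that] cos\<theta>[OF that]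
      by (simp_all flip: real_sqrt_mult add: right_diff_distrib)
    have amp: "amplitude y n \<tau> (g(t := (j, \<sigma>))) = v \<phi>"
      if "j \<in> I" "sqrt R * cos \<phi> = \<tau> * sqrt (R - y j)" "sqrt R * sin \<phi> = \<sigma> * sqrt (y j)" for \<tau> \<sigma> \<phi> j
    proof
      fix i
      show "amplitude y n \<tau> (g(t := (j, \<sigma>))) i = v \<phi> i"
        using that(2,3) total[of "(j, \<sigma>)"] by (cases i) (auto simp: amplitude_def v_def R_def algebra_simps)
    qed
    \<comment> \<open>The four choices of signs for outcomes 0 and \<open>Suc t\<close> are the four
      angles with the same squared sine.\<close>
    have quad: "mean_accept y n A S (g(t := (j, 1))) + mean_accept y n A S (g(t := (j, - 1)))
        = (accept_prob (Suc n) A S (v (\<theta> j)) + accept_prob (Suc n) A S (v (- \<theta> j))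
           + accept_prob (Suc n) A S (v (pi - \<theta> j)) + accept_prob (Suc n) A S (v (pi + \<theta> j))) / 2"
      if j: "j \<in> I" for j
    proof -
      have small: "(\<Sum>k<n. y (fst ((g(t := (j, \<sigma>))) k))) \<le> 1 / 2" for \<sigma>
        unfolding total using True y(2)[OF j] by simp
      note s = scaled[OF j]
      have a: "amplitude y n 1 (g(t := (j, 1))) = v (\<theta> j)"
        "amplitude y n 1 (g(t := (j, - 1))) = v (- \<theta> j)"
        "amplitude y n (- 1) (g(t := (j, 1))) = v (pi - \<theta> j)"
        "amplitude y n (- 1) (g(t := (j, - 1))) = v (pi + \<theta> j)"
        by (rule amp[OF j]; simp add: s sin_add sin_diff cos_add cos_diff)+
      show ?thesis unfolding mean_accept_def if_P[OF small] a by (simp add: add_divide_distrib)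
    qed
    have "(\<Sum>l\<in>I \<times> {1, - 1}. (w1 (fst l) / 2 - w0 (fst l) / 2) * mean_accept y n A S (g(t := l)))
        = (\<Sum>j\<in>I. (w1 j - w0 j) * ((accept_prob (Suc n) A S (v (\<theta> j)) + accept_prob (Suc n) A S (v (- \<theta> j))
           + accept_prob (Suc n) A S (v (pi - \<theta> j)) + accept_prob (Suc n) A S (v (pi + \<theta> j))) / 4))"
      unfolding sum_signs
    proof (intro sum.cong refl)
      fix j assume j: "j \<in> I"
      show "(w1 (fst (j, 1)) / 2 - w0 (fst (j, 1)) / 2) * mean_accept y n A S (g(t := (j, 1)))
          + (w1 (fst (j, - 1)) / 2 - w0 (fst (j, - 1)) / 2) * mean_accept y n A S (g(t := (j, - 1)))
        = (w1 j - w0 j) * ((accept_prob (Suc n) A S (v (\<theta> j)) + accept_prob (Suc n) A S (v (- \<theta> j))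
           + accept_prob (Suc n) A S (v (pi - \<theta> j)) + accept_prob (Suc n) A S (v (pi + \<theta> j))) / 4)"
        unfolding fst_conv distrib_left[symmetric] quad[OF j] diff_divide_distrib[symmetric] by simp
    qed
    then have eq: "complex_of_real (\<Sum>l\<in>I \<times> {1, - 1}. (w1 (fst l) / 2 - w0 (fst l) / 2) * mean_accept y n A S (g(t := l)))
       = (\<Sum>j\<in>I. of_real (w1 j - w0 j) * ((P (\<theta> j) + P (- \<theta> j) + P (pi - \<theta> j) + P (pi + \<theta> j)) / 4))"
      by (simp add: P_def)
    have "cmod (\<Sum>j\<in>I. of_real (w1 j - w0 j) * ((P (\<theta> j) + P (- \<theta> j) + P (pi - \<theta> j) + P (pi + \<theta> j)) / 4)) \<le> E"
      unfolding E_def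
    proof (rule trig_poly_moment_bound[OF Pt P1 I _ Z _ mass])
      fix q assume "q \<le> m"
      \<comment> \<open>The squared sine is \<open>y j / R\<close>, and \<open>R\<close> does not
        depend on \<open>j\<close>, so the vanishing moments of \<open>y\<close> carry over.\<close>
      have "(\<Sum>j\<in>I. (w1 j - w0 j) * (sin (\<theta> j))\<^sup>2 ^ q) = (\<Sum>j\<in>I. (w1 j - w0 j) * y j ^ q / R ^ q)"
        using yR(1) by (intro sum.cong refl) (simp add: sin\<theta> power_divide)
      also have "\<dots> = 0" using moments[OF \<open>q \<le> m\<close>] by (simp flip: sum_divide_distrib)
      finally show "(\<Sum>j\<in>I. (w1 j - w0 j) * (sin (\<theta> j))\<^sup>2 ^ q) = 0" .
    next
      fix j assume "j \<in> I"
      then show "(sin (\<theta> j))\<^sup>2 \<le> Z" using yR by (simp add: sin\<theta>)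
    qed
    then have "\<bar>\<Sum>l\<in>I \<times> {1, - 1}. (w1 (fst l) / 2 - w0 (fst l) / 2) * mean_accept y n A S (g(t := l))\<bar> \<le> E"
      unfolding eq[symmetric] norm_of_real .
    moreover have "0 \<le> 2 * exp (- 3 * s / 8) * (\<Prod>i\<in>{..<n} - {t}. exp (s * y (fst (g i))))"
      by (simp add: prod_nonneg)
    ultimately show ?thesis unfolding E_def[symmetric] by linarith
  next
    case False
    \<comment> \<open>The cutoff may now act on some labels only, which leaves the trivial bound 2.
      As O' exceeds 3/8, the exponential factor is at least 1 and absorbs it.\<close>
    have "\<bar>\<Sum>l\<in>I \<times> {1, - 1}. (w1 (fst l) / 2 - w0 (fst l) / 2) * mean_accept y n A S (g(t := l))\<bar>
        \<le> (\<Sum>l\<in>I \<times> {1, - 1 :: real}. \<bar>w1 (fst l) - w0 (fst l)\<bar> / 2)"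
    proof (rule order_trans[OF sum_abs], rule sum_mono)
      fix l assume l: "l \<in> I \<times> {1, - 1 :: real}"
      have "\<bar>mean_accept y n A S (g(t := l))\<bar> \<le> 1"
        using mean_accept_bounds[OF A, where y = y and f = "g(t := l)" and S = S, OF gl[OF l]] by simp
      then show "\<bar>(w1 (fst l) / 2 - w0 (fst l) / 2) * mean_accept y n A S (g(t := l))\<bar>
          \<le> \<bar>w1 (fst l) - w0 (fst l)\<bar> / 2"
        using mult_left_mono[of "\<bar>mean_accept y n A S (g(t := l))\<bar>" 1 "\<bar>w1 (fst l) - w0 (fst l)\<bar> / 2"]
        unfolding abs_mult diff_divide_distrib[symmetric] by simp
    qed
    also have "\<dots> = (\<Sum>j\<in>I. \<bar>w1 j - w0 j\<bar>)" by (simp add: sum_signs)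
    also have "\<dots> \<le> 2 * 1" using mass by simp
    also have "\<dots> \<le> 2 * exp (s * O' - 3 * s / 8)"
      using False s mult_left_mono[of "3 / 8" O' s] by simp
    also have "\<dots> \<le> E + 2 * exp (- 3 * s / 8) * (\<Prod>i\<in>{..<n} - {t}. exp (s * y (fst (g i))))"
      using E0 by (simp only: mult.assoc expO)
    finally show ?thesis unfolding E_def .
  qed
qed

text \<open>The draw is an admissible input of support size 1 + n - \<open>zeros\<close>: outcome 0
  always belongs to the support. Correctness of the algorithm then bounds every test that contains,
  or excludes, all accurate estimates.\<close>

lemma accept_prob_amplitude:
  fixes y :: "nat \<Rightarrow> real"
  assumes A: "solves_support_est d \<epsilon> (Suc n) (Suc (Suc n)) A" and d: "2 \<le> d"
    and f: "\<And>k. k < n \<Longrightarrow> (y (fst (f k)) = 0 \<or> 1 / d \<le> y (fst (f k))) \<and> \<bar>snd (f k)\<bar> = 1"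
    and le: "(\<Sum>k<n. y (fst (f k))) \<le> 1 / 2" and \<tau>: "\<bar>\<tau>\<bar> = 1"
    and Z: "zeros = card {k. k < n \<and> y (fst (f k)) = 0}"
  shows "(\<And>x. \<bar>x - (1 + real n - real zeros)\<bar> \<le> \<epsilon> * d \<Longrightarrow> S x)
           \<Longrightarrow> 2 / 3 \<le> accept_prob (Suc n) A S (amplitude y n \<tau> f)"
    and "(\<And>x. \<bar>x - (1 + real n - real zeros)\<bar> \<le> \<epsilon> * d \<Longrightarrow> \<not> S x)
           \<Longrightarrow> accept_prob (Suc n) A S (amplitude y n \<tau> f) \<le> 1 / 3"
proof -
  define v where "v = amplitude y n \<tau> f"
  define p where "p i = (v i)\<^sup>2" for i
  have y0: "0 \<le> y (fst (f k))" if "k < n" for k using f[OF that] d by (auto intro: order_trans[of 0 "1 / d"])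
  have y0': "0 \<le> y (fst (f k)) \<and> \<bar>snd (f k)\<bar> = 1" if "k < n" for k using y0 f that by blast
  have le1: "(\<Sum>k<n. y (fst (f k))) \<le> 1" using le by simp
  have amp: "(v 0)\<^sup>2 = 1 - (\<Sum>k<n. y (fst (f k)))" "(\<Sum>i<Suc n. (v i)\<^sup>2) = 1"
    and ampk: "\<And>k. k < n \<Longrightarrow> (v (Suc k))\<^sup>2 = y (fst (f k))"
    unfolding v_def by (rule sum_amplitude_squares[OF y0' le1 \<tau>]; assumption)+
  \<comment> \<open>With \<open>2 \<le> d\<close> this also gives outcome 0 the required probability
    \<open>1 / d\<close>.\<close>
  have p0: "1 / 2 \<le> p 0" using amp(1) le by (simp add: p_def)
  have pk: "p (Suc k) = y (fst (f k))" if "k < n" for k using ampk[OF that] by (simp add: p_def)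
  have valid: "valid_dist d (Suc n) p"
    unfolding valid_dist_def
  proof (intro conjI allI impI)
    show "(\<Sum>i<Suc n. p i) = 1" using amp(2) by (simp add: p_def)
    fix i assume i: "i < Suc n" "0 < p i"
    show "1 / d \<le> p i"
    proof (cases i)
      case 0
      have "1 / d \<le> 1 / 2" using d by (simp add: field_simps)
      then show ?thesis using p0 0 by simp
    next
      case (Suc k)
      then show ?thesis using i f[of k] pk[of k] by auto
    qed
  qed (simp add: p_def)
  have "{i. i < Suc n \<and> 0 < p i} = insert 0 (Suc ` {k. k < n \<and> y (fst (f k)) \<noteq> 0})"
  proof (rule Set.set_eqI)
    fix i
    show "i \<in> {i. i < Suc n \<and> 0 < p i} \<longleftrightarrow> i \<in> insert 0 (Suc ` {k. k < n \<and> y (fst (f k)) \<noteq> 0})"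
    proof (cases i)
      case 0
      then show ?thesis using p0 by simp
    next
      case (Suc k)
      then show ?thesis using pk[of k] y0[of k] by (auto simp: order_less_le)
    qed
  qed
  then have "support_size (Suc n) p = Suc (card {k. k < n \<and> y (fst (f k)) \<noteq> 0})"
    unfolding support_size_def by (simp add: card_insert_if card_image)
  moreover have "card {k. k < n \<and> y (fst (f k)) = 0} + card {k. k < n \<and> y (fst (f k)) \<noteq> 0} = n"
    using card_Un_disjoint[of "{k. k < n \<and> y (fst (f k)) = 0}" "{k. k < n \<and> y (fst (f k)) \<noteq> 0}"]
    by (auto simp: disjoint_iff Un_def Collect_disj_eq[symmetric] conj_disj_distribL[symmetric])
  ultimately have supp: "real (support_size (Suc n) p) = 1 + real n - real zeros"
    unfolding Z by linarith
  have orc: "purified_oracle (Suc n) (Suc (Suc n)) p (swap_oracle (Suc n) v)"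
    unfolding p_def by (intro purified_oracle_swap_oracle amp(2)) simp
  have good: "2 / 3 \<le> accept_prob (Suc n) A (\<lambda>x. \<bar>x - (1 + real n - real zeros)\<bar> \<le> \<epsilon> * d) v"
    using A valid orc unfolding solves_support_est_def accept_prob_def supp[symmetric] by blast
  have mono: "accept_prob (Suc n) A S v \<le> accept_prob (Suc n) A S' v" if "\<And>x. S x \<Longrightarrow> S' x" for S S'
    unfolding accept_prob_def using that by (rule prob_output_mono)
  show "2 / 3 \<le> accept_prob (Suc n) A S (amplitude y n \<tau> f)" if "\<And>x. \<bar>x - (1 + real n - real zeros)\<bar> \<le> \<epsilon> * d \<Longrightarrow> S x"
    unfolding v_def[symmetric] by (rule order_trans[OF good mono]) (rule that)
  have wf: "well_formed_alg (Suc n) (Suc (Suc n)) A" using A by (simp add: solves_support_est_def)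
  have "accept_prob (Suc n) A S v + accept_prob (Suc n) A (\<lambda>x. \<not> S x) v = 1"
    unfolding accept_prob_def
    by (intro prob_output_compl[OF wf is_unitary_swap_oracle[OF amp(2)]]) simp_all
  moreover have "2 / 3 \<le> accept_prob (Suc n) A (\<lambda>x. \<not> S x) v"
    if "\<And>x. \<bar>x - (1 + real n - real zeros)\<bar> \<le> \<epsilon> * d \<Longrightarrow> \<not> S x"
    by (rule order_trans[OF good mono]) (rule that)
  ultimately show "accept_prob (Suc n) A S (amplitude y n \<tau> f) \<le> 1 / 3" if "\<And>x. \<bar>x - (1 + real n - real zeros)\<bar> \<le> \<epsilon> * d \<Longrightarrow> \<not> S x"
    unfolding v_def[symmetric] using that by fastforce
qed

text \<open>Under \<open>w1\<close> no drawn probability is 0, so the support size is n + 1; under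
  \<open>w0\<close> about n \<gamma> of them are 0. An accurate algorithm tells these cases apart
  with advantage 1/3, up to the three errors on the right: exchange of the priors, draws that are
  too heavy, and draws from \<open>w0\<close> with too few zeros.\<close>

lemma separation_bound:
  fixes I :: "nat set" and y w0 w1 :: "nat \<Rightarrow> real"
  assumes A: "solves_support_est d \<epsilon> (Suc n) (Suc (Suc n)) A" and d: "2 \<le> d" and I: "finite I"
    and y: "\<And>j. j \<in> I \<Longrightarrow> y j = 0 \<or> 1 / d \<le> y j" "\<And>j. j \<in> I \<Longrightarrow> y j \<le> 1 / 8"
      "\<And>j. j \<in> I \<Longrightarrow> 2 * y j \<le> Z" and Z: "0 \<le> Z"
    and w0: "\<And>j. 0 \<le> w0 j" "(\<Sum>j\<in>I. w0 j) = 1"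
    and w1: "\<And>j. 0 \<le> w1 j" "(\<Sum>j\<in>I. w1 j) = 1" "\<And>j. y j = 0 \<Longrightarrow> w1 j = 0"
    and \<gamma>: "(\<Sum>j\<in>I. if y j = 0 then w0 j else 0) = \<gamma>"
    and moments: "\<And>q. q \<le> m \<Longrightarrow> (\<Sum>j\<in>I. (w1 j - w0 j) * y j ^ q) = 0"
    and s: "0 \<le> s" and B: "1 \<le> B" "(\<Sum>j\<in>I. w0 j * exp (s * y j)) \<le> B" "(\<Sum>j\<in>I. w1 j * exp (s * y j)) \<le> B"
    and gap: "2 * \<epsilon> * d < real n * \<gamma> / 2"
  defines "K \<equiv> 4 * nqueries A"
  shows "1 / 3 \<le> real n * (2 * real (2 * K + 1) *
        (\<Sum>j\<in>{m<..K}. (2 * real K) ^ (2 * j) * Z ^ j / fact (2 * j)))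
      + (2 * real n + 1) * (exp (- 3 * s / 8) * B ^ n) + exp (- real n * \<gamma> / 12)"
proof -
  define E where "E = 2 * real (2 * K + 1) *
        (\<Sum>j\<in>{m<..K}. (2 * real K) ^ (2 * j) * Z ^ j / fact (2 * j))"
  \<comment> \<open>The threshold is the lowest accurate estimate for support size n + 1. By
    \<open>gap\<close> it lies above every accurate estimate once there are at least n \<gamma> / 2
    zeros.\<close>
  define S where "S x \<longleftrightarrow> 1 + real n - \<epsilon> * d \<le> x" for x
  define J where "J = I \<times> {1, - 1 :: real}"
  define W0 W1 where "W0 l = w0 (fst l) / 2" and "W1 l = w1 (fst l) / 2" for l :: "nat \<times> real"
  define F where "F = mean_accept y n A S"
  define h where "h l = exp (s * y (fst l))" for l :: "nat \<times> real"
  define \<delta> where "\<delta> = exp (- 3 * s / 8) * B ^ n"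
  have wf: "well_formed_alg (Suc n) (Suc (Suc n)) A" using A by (simp add: solves_support_est_def)
  have J: "finite J" using I by (simp add: J_def)
  have sumJ: "(\<Sum>l\<in>J. w (fst l) / 2 * k (fst l)) = (\<Sum>j\<in>I. w j * k j)" for w k :: "nat \<Rightarrow> real"
    unfolding J_def sum_signs by (simp add: mult.commute)
  have sums: "(\<Sum>l\<in>J. W0 l) = 1" "(\<Sum>l\<in>J. W1 l) = 1"
    "(\<Sum>l\<in>J. W0 l * h l) \<le> B" "(\<Sum>l\<in>J. W1 l * h l) \<le> B"
    using sumJ[of w0 "\<lambda>_. 1"] sumJ[of w1 "\<lambda>_. 1"] sumJ[of w0 "\<lambda>j. exp (s * y j)"] sumJ[of w1 "\<lambda>j. exp (s * y j)"]
      w0(2) w1(2) B by (simp_all add: W0_def W1_def h_def)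
  have pos: "0 \<le> W0 l" "0 \<le> W1 l" "0 \<le> h l" for l using w0 w1 by (simp_all add: W0_def W1_def h_def)
  have yn: "0 \<le> y j" if "j \<in> I" for j using y(1)[OF that] d by (auto intro: order_trans[of 0 "1 / d"])
  have mass: "(\<Sum>j\<in>I. \<bar>w1 j - w0 j\<bar>) \<le> 2"
  proof -
    have "(\<Sum>j\<in>I. \<bar>w1 j - w0 j\<bar>) \<le> (\<Sum>j\<in>I. w1 j + w0 j)"
    proof (intro sum_mono)
      fix j show "\<bar>w1 j - w0 j\<bar> \<le> w1 j + w0 j" using w0(1)[of j] w1(1)[of j] by linarith
    qed
    then show ?thesis using w0(2) w1(2) by (simp add: sum.distrib)
  qed
  have hyb: "\<bar>prod_expect {..<n} J (\<lambda>_. W1) F - prod_expect {..<n} J (\<lambda>_. W0) F\<bar>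
      \<le> real n * (E + (2 * exp (- 3 * s / 8)) * B ^ n)"
  proof (rule hybrid_bound[OF J pos(1) sums(1) pos(2) sums(2) pos(3) sums(3,4) B(1)])
    fix t g assume "t < n" "g \<in> ({..<n} - {t}) \<rightarrow>\<^sub>E J"
    then show "\<bar>\<Sum>l\<in>J. (W1 l - W0 l) * F (g(t := l))\<bar>
        \<le> E + 2 * exp (- 3 * s / 8) * (\<Prod>i\<in>{..<n} - {t}. h (g i))"
      unfolding J_def W0_def W1_def F_def E_def h_def K_def
      by (intro mean_accept_step[OF wf I yn y(2,3) Z mass moments _ _ s]) auto
  qed simp
  have fJ: "f k \<in> J" if "f \<in> {..<n} \<rightarrow>\<^sub>E J" "k < n" for f k using PiE_mem[OF that(1)] that(2) by simp
  have fk: "(y (fst (f k)) = 0 \<or> 1 / d \<le> y (fst (f k))) \<and> \<bar>snd (f k)\<bar> = 1"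
    if "f \<in> {..<n} \<rightarrow>\<^sub>E J" "k < n" for f k
  proof -
    have "fst (f k) \<in> I" "\<bar>snd (f k)\<bar> = 1" using fJ[OF that] by (auto simp: J_def)
    then show ?thesis using y(1) by blast
  qed
  have fb: "0 \<le> y (fst (f k)) \<and> \<bar>snd (f k)\<bar> = 1" if "f \<in> {..<n} \<rightarrow>\<^sub>E J" "k < n" for f k
    using fk[OF that] d by (auto intro: order_trans[of 0 "1 / d"])
  define zeros where "zeros f = card {k. k < n \<and> y (fst (f k)) = 0}" for f :: "nat \<Rightarrow> nat \<times> real"
  \<comment> \<open>Exponential Markov bound for totals above 1/2, weakened to the exponent 3/8 so
    that the same quantity \<delta> serves here and in the exchange step.\<close>
  have tail: "exp (- 3 * s / 8) * (\<Prod>i<n. h (f i)) \<ge> 1" if "1 / 2 < (\<Sum>k<n. y (fst (f k)))" for f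
  proof -
    have "exp (- 3 * s / 8) * (\<Prod>i<n. h (f i)) = exp (s * ((\<Sum>k<n. y (fst (f k))) - 3 / 8))"
      unfolding h_def by (simp add: exp_sum[symmetric] exp_add[symmetric] right_diff_distrib sum_distrib_left)
    moreover have "0 \<le> s * ((\<Sum>k<n. y (fst (f k))) - 3 / 8)" using that s by simp
    ultimately show ?thesis by simp
  qed
  have tail_pos: "0 \<le> exp (- 3 * s / 8) * (\<Prod>i<n. h (f i))" for f
    by (simp add: h_def prod_nonneg)
  have "2 / 3 \<le> prod_expect {..<n} J (\<lambda>_. W1) F + \<delta>"
  proof -
    have "2 / 3 = prod_expect {..<n} J (\<lambda>_. W1) (\<lambda>_. 2 / 3)"
      using prod_expect_const[OF _ J, of "{..<n}" "\<lambda>_. W1"] sums(2) by simp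
    also have "\<dots> \<le> prod_expect {..<n} J (\<lambda>_. W1) (\<lambda>f. F f + exp (- 3 * s / 8) * (\<Prod>i<n. h (f i)))"
    proof (rule prod_expect_mono)
      fix f assume f: "f \<in> {..<n} \<rightarrow>\<^sub>E J" and nz: "(\<Prod>i<n. W1 (f i)) \<noteq> 0"
      have F0: "0 \<le> F f" unfolding F_def
        by (rule mean_accept_bounds(1)[OF wf]) (rule fb[OF f])
      show "2 / 3 \<le> F f + exp (- 3 * s / 8) * (\<Prod>i<n. h (f i))"
      proof (cases "(\<Sum>k<n. y (fst (f k))) \<le> 1 / 2")
        case True
        have nz': "W1 (f k) \<noteq> 0" if "k < n" for k using nz that by (auto simp: prod_zero_iff)
        have "{k. k < n \<and> y (fst (f k)) = 0} = {}" using nz' w1(3) by (auto simp: W1_def)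
        then have z: "0 = card {k. k < n \<and> y (fst (f k)) = 0}" by simp
        have "2 / 3 \<le> accept_prob (Suc n) A S (amplitude y n \<tau> f)" if "\<bar>\<tau>\<bar> = 1" for \<tau>
          by (rule accept_prob_amplitude(1)[OF A d fk[OF f] True that z]) (auto simp: S_def)
        from this[of 1] this[of "-1"] show ?thesis
          using True tail_pos[of f] by (simp add: F_def mean_accept_def add_divide_distrib)
      next
        case False
        then show ?thesis using tail[of f] F0 by simp
      qed
    qed (simp add: pos)
    also have "\<dots> = prod_expect {..<n} J (\<lambda>_. W1) F + exp (- 3 * s / 8) * (\<Sum>l\<in>J. W1 l * h l) ^ n"
      unfolding prod_expect_add prod_expect_cmult using prod_expect_prod[OF _ J, of "{..<n}" "\<lambda>_. W1" "\<lambda>_. h"] by simp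
    also have "\<dots> \<le> prod_expect {..<n} J (\<lambda>_. W1) F + \<delta>"
      unfolding \<delta>_def using sums(4) pos by (intro add_left_mono mult_left_mono power_mono sum_nonneg) auto
    finally show ?thesis .
  qed
  moreover have "prod_expect {..<n} J (\<lambda>_. W0) F \<le> 1 / 3 + exp (- real n * \<gamma> / 12)"
  proof -
    \<comment> \<open>Lower-tail Chernoff bound for the number of zeros, with parameter 1/2. Since 1
      - exp (-1/2) is at least 1/3, the exponent is n \<gamma> (1/4 - 1/3) = - n \<gamma> /
      12.\<close>
    define k where "k l = (if y (fst l) = 0 then exp (- 1 / 2) else 1 :: real)" for l :: "nat \<times> real"
    have prodk: "(\<Prod>i<n. k (f i)) = exp (- real (zeros f) / 2)" for f
    proof -
      have "(\<Prod>i<n. k (f i)) = exp (\<Sum>i<n. if y (fst (f i)) = 0 then - 1 / 2 else 0)"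
        unfolding exp_sum[OF finite_lessThan] by (intro prod.cong) (auto simp: k_def)
      also have "(\<Sum>i<n. if y (fst (f i)) = 0 then - 1 / 2 else 0)
          = (\<Sum>i\<in>{i. i < n \<and> y (fst (f i)) = 0}. - 1 / 2 :: real)"
        by (rule sum.mono_neutral_cong_right) auto
      also have "\<dots> = - real (zeros f) / 2" by (simp add: zeros_def)
      finally show ?thesis .
    qed
    have "prod_expect {..<n} J (\<lambda>_. W0) F
        \<le> prod_expect {..<n} J (\<lambda>_. W0) (\<lambda>f. 1 / 3 + exp (real n * \<gamma> / 4) * (\<Prod>i<n. k (f i)))"
    proof (rule prod_expect_mono)
      fix f assume f: "f \<in> {..<n} \<rightarrow>\<^sub>E J"
      have F1: "F f \<le> 1" unfolding F_def
        by (rule mean_accept_bounds(2)[OF wf]) (rule fb[OF f])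
      have e: "exp (real n * \<gamma> / 4) * (\<Prod>i<n. k (f i)) = exp ((real n * \<gamma> / 2 - real (zeros f)) / 2)"
        unfolding prodk exp_add[symmetric] by (simp add: diff_divide_distrib)
      show "F f \<le> 1 / 3 + exp (real n * \<gamma> / 4) * (\<Prod>i<n. k (f i))"
      proof (cases "real n * \<gamma> / 2 \<le> real (zeros f)")
        case True
        have no: "accept_prob (Suc n) A S (amplitude y n \<tau> f) \<le> 1 / 3"
          if "(\<Sum>k<n. y (fst (f k))) \<le> 1 / 2" "\<bar>\<tau>\<bar> = 1" for \<tau>
          using True gap
          by (intro accept_prob_amplitude(2)[OF A d fk[OF f] that zeros_def]) (auto simp: S_def)
        have "F f \<le> 1 / 3" using no[of 1] no[of "-1"] by (auto simp: F_def mean_accept_def add_divide_distrib)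
        then show ?thesis
          unfolding e using exp_gt_zero[of "(real n * \<gamma> / 2 - real (zeros f)) / 2"] by linarith
      next
        case False
        then have "1 \<le> exp ((real n * \<gamma> / 2 - real (zeros f)) / 2)" by simp
        then show ?thesis unfolding e using F1 by linarith
      qed
    qed (simp add: pos)
    also have "\<dots> = 1 / 3 + exp (real n * \<gamma> / 4) * (\<Sum>l\<in>J. W0 l * k l) ^ n"
      unfolding prod_expect_add prod_expect_cmult using prod_expect_prod[OF _ J, of "{..<n}" "\<lambda>_. W0" "\<lambda>_. k"]
      using prod_expect_const[OF _ J, of "{..<n}" "\<lambda>_. W0"] sums(1) by simp
    also have "\<dots> \<le> 1 / 3 + exp (real n * \<gamma> / 4) * exp (- \<gamma> / 3) ^ n"
    proof (intro add_left_mono mult_left_mono power_mono)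
      have "(\<Sum>l\<in>J. W0 l * k l) = (\<Sum>j\<in>I. w0 j * (if y j = 0 then exp (- 1 / 2) else 1))"
        using sumJ[of w0 "\<lambda>j. if y j = 0 then exp (- 1 / 2) else 1"] by (simp add: W0_def k_def)
      also have "\<dots> = (\<Sum>j\<in>I. w0 j - (1 - exp (- 1 / 2)) * (if y j = 0 then w0 j else 0))"
        by (intro sum.cong) (auto simp: algebra_simps)
      also have "\<dots> = 1 - (1 - exp (- 1 / 2)) * \<gamma>"
        unfolding sum_subtractf sum_distrib_left[symmetric] \<gamma> w0(2) ..
      also have "\<dots> \<le> 1 - 1 / 3 * \<gamma>"
      proof -
        have "(3 / 2 :: real) \<le> exp (1 / 2)" using exp_ge_add_one_self[of "1 / 2 :: real"] by simp
        then have "exp (- 1 / 2) \<le> (2 / 3 :: real)" by (simp add: exp_minus field_simps)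
        moreover have "0 \<le> \<gamma>" unfolding \<gamma>[symmetric] using w0(1) by (intro sum_nonneg) auto
        ultimately have "1 / 3 * \<gamma> \<le> (1 - exp (- 1 / 2)) * \<gamma>" by (intro mult_right_mono) auto
        then show ?thesis by simp
      qed
      also have "\<dots> \<le> exp (- \<gamma> / 3)" using exp_ge_add_one_self[of "- \<gamma> / 3"] by simp
      finally show "(\<Sum>l\<in>J. W0 l * k l) \<le> exp (- \<gamma> / 3)" .
      show "0 \<le> (\<Sum>l\<in>J. W0 l * k l)" using pos by (intro sum_nonneg mult_nonneg_nonneg) (auto simp: k_def)
    qed simp
    also have "exp (real n * \<gamma> / 4) * exp (- \<gamma> / 3) ^ n = exp (- real n * \<gamma> / 12)"
      unfolding exp_of_nat_mult[symmetric] exp_add[symmetric] by (simp add: field_simps)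
    finally show ?thesis .
  qed
  ultimately have "1 / 3 \<le> real n * (E + 2 * exp (- 3 * s / 8) * B ^ n) + \<delta> + exp (- real n * \<gamma> / 12)"
    using hyb by (simp add: abs_le_iff)
  also have "\<dots> = real n * E + (2 * real n + 1) * \<delta> + exp (- real n * \<gamma> / 12)"
    by (simp add: \<delta>_def algebra_simps)
  finally show ?thesis unfolding E_def \<delta>_def .
qed

section \<open>The lower bound\<close>

text \<open>A weak form of Stirling's formula, by induction from (1 + 1/m)^m at most e.\<close>

lemma power_self_le_exp_fact: "real m ^ m \<le> exp (real m) * fact m"
proof (induction m)
  case (Suc m)
  have "real (Suc m) ^ m \<le> exp 1 * real m ^ m"
  proof (cases "m = 0")
    case False
    have "real (Suc m) = (1 + 1 / real m) * real m" using False by (simp add: field_simps)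
    then have "real (Suc m) ^ m = (1 + 1 / real m) ^ m * real m ^ m" by (simp add: power_mult_distrib)
    also have "\<dots> \<le> exp (1 / real m) ^ m * real m ^ m"
      by (intro mult_right_mono power_mono) (auto simp: add.commute)
    also have "exp (1 / real m) ^ m = exp 1" using False by (simp flip: exp_of_nat_mult)
    finally show ?thesis .
  qed simp
  then have "real (Suc m) ^ Suc m \<le> real (Suc m) * (exp 1 * real m ^ m)"
    by (simp add: mult_left_mono del: of_nat_Suc)
  also have "\<dots> \<le> real (Suc m) * (exp 1 * (exp (real m) * fact m))"
    using Suc by (intro mult_left_mono) auto
  also have "\<dots> = exp (real (Suc m)) * fact (Suc m)" by (simp add: exp_add algebra_simps)
  finally show ?case .
qed simp

lemma exp_minus_double_le:
  fixes x :: real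
  assumes "0 \<le> x" "x \<le> 1 / 2"
  shows "exp (- 2 * x) \<le> 1 - x"
proof -
  have "1 \<le> (1 - x) * (1 + 2 * x)"
    using assms mult_left_mono[of "2 * x" 1 x] by (simp add: algebra_simps)
  also have "\<dots> \<le> (1 - x) * exp (2 * x)"
    using assms exp_ge_add_one_self[of "2 * x"] by (intro mult_left_mono) auto
  finally show ?thesis by (simp add: exp_minus field_simps)
qed

text \<open>Bounding (2j)! from below by (2j/e)^(2j) turns the term into the j-th power of K^2 Z e^2
  / j^2, a base of at most e^(-4) by assumption.\<close>

lemma taylor_tail_bound:
  assumes b: "0 < b" and "0 \<le> Z" and small: "K\<^sup>2 * Z * exp 2 \<le> exp (- 4) * (real b)\<^sup>2" and j: "b \<le> j"
  shows "(2 * K) ^ (2 * j) * Z ^ j / fact (2 * j) \<le> exp (- 4 * real b)"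
proof -
  have jb: "(real b)\<^sup>2 \<le> (real j)\<^sup>2" using j by (intro power_mono) auto
  have j0: "0 < real (2 * j) ^ (2 * j)" using b j by simp
  have "real (2 * j) ^ (2 * j) \<le> exp 2 ^ j * fact (2 * j)"
    using power_self_le_exp_fact[of "2 * j"] by (simp flip: exp_of_nat_mult add: mult.commute)
  moreover have "0 \<le> (2 * K) ^ (2 * j) * Z ^ j" using assms(2) by (simp add: power_mult)
  ultimately have "(2 * K) ^ (2 * j) * Z ^ j * real (2 * j) ^ (2 * j)
      \<le> (2 * K) ^ (2 * j) * Z ^ j * (exp 2 ^ j * fact (2 * j))"
    by (intro mult_left_mono)
  then have "(2 * K) ^ (2 * j) * Z ^ j / fact (2 * j)
      \<le> (2 * K) ^ (2 * j) * Z ^ j * exp 2 ^ j / real (2 * j) ^ (2 * j)"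
    using j0 by (simp add: divide_le_eq le_divide_eq mult_ac del: of_nat_mult)
  also have "\<dots> = (K\<^sup>2 * Z * exp 2 / (real j)\<^sup>2) ^ j"
    by (simp add: power_mult power_mult_distrib power_divide)
  also have "\<dots> \<le> exp (- 4) ^ j"
  proof (rule power_mono)
    have "K\<^sup>2 * Z * exp 2 \<le> exp (- 4) * (real j)\<^sup>2"
      using small jb by (meson exp_ge_zero mult_left_mono order_trans)
    then show "K\<^sup>2 * Z * exp 2 / (real j)\<^sup>2 \<le> exp (- 4)" using b j by (simp add: divide_le_eq)
  qed (use assms(2) in simp)
  also have "\<dots> = exp (- 4 * real j)" by (simp flip: exp_of_nat_mult add: mult.commute)
  also have "\<dots> \<le> exp (- 4 * real b)" using j by simp
  finally show ?thesis .
qed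

text \<open>Too few queries would make the three errors of \<open>separation_bound\<close> sum to
  less than 1/3. The conditions on \<open>D\<close> hold for all large \<open>D\<close>.\<close>

lemma query_lower_bound:
  fixes D \<epsilon> :: real
  assumes D: "1000 \<le> D" "98304 * ln D ^ 3 \<le> D" "13824 \<le> sqrt D" "ln D \<le> sqrt D" "1 \<le> ln D"
    and \<epsilon>: "1 / D \<le> \<epsilon>" "\<epsilon> \<le> 1 / 1000000"
  shows "\<exists>n. \<forall>A. solves_support_est D \<epsilon> (Suc n) (Suc (Suc n)) A \<longrightarrow>
    1 / 10000 * sqrt D * ln (1 / \<epsilon>) \<le> real (nqueries A)"
proof -
  define l where "l = ln (1 / \<epsilon>)"
  have D0: "0 < D" using D by simp
  have \<epsilon>0: "0 < \<epsilon>" using D0 by (intro less_le_trans[OF _ \<epsilon>(1)]) simp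
  have l1: "1 \<le> l"
  proof -
    have "exp 1 \<le> (3 :: real)" by (rule exp_le)
    also have "\<dots> \<le> 1 / \<epsilon>" using \<epsilon>(2) \<epsilon>0 by (simp add: field_simps)
    finally show ?thesis unfolding l_def using \<epsilon>0 by (subst ln_ge_iff) auto
  qed
  have lD: "l \<le> ln D"
    unfolding l_def using \<epsilon>(1) \<epsilon>0 D0 by (intro ln_mono) (auto simp: field_simps)
  \<comment> \<open>\<open>u\<close> is the square root of \<epsilon>.\<close>
  define u where "u = exp (- l / 2)"
  have u2: "u\<^sup>2 = \<epsilon>"
    using \<epsilon>0 by (simp add: u_def l_def power2_eq_square ln_div flip: exp_add)
  have u0: "0 < u" by (simp add: u_def)
  have u1: "u \<le> 1 / 1000"
    by (rule power2_le_imp_le) (use \<epsilon>(2) u2 in \<open>auto simp: power2_eq_square\<close>)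
  have uD: "1 / sqrt D \<le> u"
    by (rule power2_le_imp_le) (use \<epsilon>(1) u2 u0 D0 in \<open>auto simp: power_divide\<close>)
  \<comment> \<open>Matching about ln D moments makes each remaining Taylor term at most
    D^(-4).\<close>
  define b where "b = nat \<lceil>ln D\<rceil>"
  have b: "ln D \<le> real b" "real b \<le> 2 * ln D" using D(5) unfolding b_def by linarith+
  have b0: "0 < b" using b(1) D(5) by (cases b) auto
  \<comment> \<open>This balances two demands: 1 - \<rho> of order l / b keeps the range \<Lambda>
    of order (b / l)^2, while \<rho>^(3b) stays above the square root of \<epsilon>.\<close>
  define \<rho> where "\<rho> = 1 - l / (16 * real b)"
  have lb: "l / (16 * real b) \<le> 1 / 16" "0 < l / (16 * real b)"
    using l1 lD b b0 by (auto simp: field_simps)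
  have \<rho>: "0 < \<rho>" "\<rho> < 1" using lb by (auto simp: \<rho>_def)
  define \<Lambda> where "\<Lambda> = ((1 + \<rho>) / (1 - \<rho>))\<^sup>2"
  have \<Lambda>le: "\<Lambda> \<le> 1024 * (real b)\<^sup>2 / l\<^sup>2"
  proof -
    have "(1 + \<rho>) / (1 - \<rho>) \<le> 2 / (1 - \<rho>)"
      using \<rho> by (intro divide_right_mono) auto
    also have "\<dots> = 32 * real b / l" by (simp add: \<rho>_def)
    finally have "\<Lambda> \<le> (32 * real b / l)\<^sup>2" unfolding \<Lambda>_def using \<rho> by (intro power_mono) auto
    then show ?thesis by (simp add: power_divide power_mult_distrib)
  qed
  have \<Lambda>1: "1 \<le> \<Lambda>" unfolding \<Lambda>_def using \<rho> by (intro one_le_power) (simp add: le_divide_eq)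
  have \<Lambda>D: "\<Lambda> \<le> 4096 * (ln D)\<^sup>2"
  proof -
    have "1024 * (real b)\<^sup>2 / l\<^sup>2 \<le> 1024 * (real b)\<^sup>2 / 1"
      using l1 by (intro divide_left_mono) (auto intro: one_le_power)
    also have "\<dots> \<le> 1024 * (2 * ln D)\<^sup>2" using b(2) by (simp only: div_by_1) (intro mult_left_mono power_mono, auto)
    finally show ?thesis using \<Lambda>le by (simp add: power_mult_distrib)
  qed
  \<comment> \<open>The constant 98304 is 3 * 8 * 4096.\<close>
  have D\<Lambda>: "3 * ln D \<le> D / (8 * \<Lambda>)"
  proof -
    have "3 * ln D * (8 * \<Lambda>) \<le> 3 * ln D * (8 * (4096 * (ln D)\<^sup>2))"
      using \<Lambda>D D(5) by (intro mult_left_mono) auto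
    also have "\<dots> = 98304 * ln D ^ 3" by (simp add: power3_eq_cube power2_eq_square)
    also have "\<dots> \<le> D" by (rule D(2))
    finally show ?thesis using \<Lambda>1 by (simp add: le_divide_eq)
  qed
  \<comment> \<open>The exponent obtained is 3 l / 8, within the allowed l / 2.\<close>
  have \<rho>pow: "u \<le> \<rho> ^ (3 * b)"
  proof -
    have "u \<le> exp (- 2 * (l / (16 * real b))) ^ (3 * b)"
      unfolding u_def exp_of_nat_mult[symmetric] using l1 b0 by (simp add: field_simps)
    also have "\<dots> \<le> \<rho> ^ (3 * b)"
      unfolding \<rho>_def using lb by (intro power_mono exp_minus_double_le) auto
    finally show ?thesis .
  qed
  obtain w0 w1 X :: "nat \<Rightarrow> real" and \<kappa> \<gamma> :: real where
    "\<forall>i. 0 \<le> w0 i \<and> 0 \<le> w1 i"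
    and sums: "(\<Sum>i\<le>4 * b. w0 i) = 1" "(\<Sum>i\<le>4 * b. w1 i) = 1"
    and "\<forall>i. X i = 0 \<or> 1 \<le> X i \<and> X i \<le> \<Lambda>"
    and "\<forall>q\<le>Suc b. (\<Sum>i\<le>4 * b. (w1 i - w0 i) * X i ^ q) = 0"
    and "\<forall>i. X i = 0 \<longrightarrow> w1 i = 0"
    and \<kappa>: "(\<Sum>i\<le>4 * b. w1 i * X i) = \<kappa>"
    and \<gamma>: "(\<Sum>i\<le>4 * b. if X i = 0 then w0 i else 0) = \<gamma>"
    and ratio: "\<kappa> * (2 * real b * (1 - \<rho>) * \<rho> ^ (3 * b)) \<le> \<gamma>"
    by (rule moment_matching[OF b0 \<rho>, folded \<Lambda>_def], rule that)
  then have w: "\<And>i. 0 \<le> w0 i" "\<And>i. 0 \<le> w1 i"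
    and X: "\<And>i. X i = 0 \<or> 1 \<le> X i \<and> X i \<le> \<Lambda>"
    and mom: "\<And>q. q \<le> Suc b \<Longrightarrow> (\<Sum>i\<le>4 * b. (w1 i - w0 i) * X i ^ q) = 0"
    and w10: "\<And>i. X i = 0 \<Longrightarrow> w1 i = 0"
    by blast+
  have X0: "0 \<le> X j" "X j \<le> \<Lambda>" for j using X[of j] \<Lambda>1 by auto
  have \<kappa>0: "(\<Sum>i\<le>4 * b. w0 i * X i) = \<kappa>"
    using mom[of 1] \<kappa> by (simp add: left_diff_distrib sum_subtractf)
  have \<kappa>1: "1 \<le> \<kappa>"
  proof -
    have "(\<Sum>i\<le>4 * b. w1 i) \<le> (\<Sum>i\<le>4 * b. w1 i * X i)"
    proof (intro sum_mono)
      fix i show "w1 i \<le> w1 i * X i"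
        using X[of i] w10[of i] mult_left_mono[of 1 "X i" "w1 i"] w(2)[of i] by auto
    qed
    then show ?thesis using sums \<kappa> by simp
  qed
  have \<kappa>\<Lambda>: "\<kappa> \<le> \<Lambda>"
  proof -
    have "(\<Sum>i\<le>4 * b. w1 i * X i) \<le> (\<Sum>i\<le>4 * b. w1 i * \<Lambda>)"
      using X0 w by (intro sum_mono mult_left_mono)
    then show ?thesis using sums \<kappa> by (simp flip: sum_distrib_right)
  qed
  have \<gamma>\<kappa>: "\<kappa> * (l * u / 8) \<le> \<gamma>"
  proof -
    have "l * u / 8 \<le> l * \<rho> ^ (3 * b) / 8" using \<rho>pow l1 by (simp add: mult_left_mono)
    also have "\<dots> = 2 * real b * (1 - \<rho>) * \<rho> ^ (3 * b)" using b0 by (simp add: \<rho>_def)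
    finally have "\<kappa> * (l * u / 8) \<le> \<kappa> * (2 * real b * (1 - \<rho>) * \<rho> ^ (3 * b))"
      using \<kappa>1 by (intro mult_left_mono) auto
    then show ?thesis using ratio by (rule order_trans)
  qed
  \<comment> \<open>The expected total of the drawn probabilities, n \<kappa> / D, is then at most
    1/8.\<close>
  define n where "n = nat \<lfloor>D / (8 * \<kappa>)\<rfloor>"
  have q1: "1 \<le> D / (8 * \<kappa>)"
  proof -
    have "1 \<le> D / (8 * \<Lambda>)" using D\<Lambda> D(5) by linarith
    also have "\<dots> \<le> D / (8 * \<kappa>)" using \<kappa>\<Lambda> \<kappa>1 D0 by (intro divide_left_mono) auto
    finally show ?thesis .
  qed
  have n: "real n \<le> D / (8 * \<kappa>)" "D / (8 * \<kappa>) / 2 \<le> real n"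
  proof -
    have "real (nat \<lfloor>x\<rfloor>) \<le> x \<and> x / 2 \<le> real (nat \<lfloor>x\<rfloor>)" if "1 \<le> x" for x :: real
    proof -
      have "1 \<le> \<lfloor>x\<rfloor>" using that by simp
      then show ?thesis by linarith
    qed
    from this[OF q1] show "real n \<le> D / (8 * \<kappa>)" "D / (8 * \<kappa>) / 2 \<le> real n"
      unfolding n_def by blast+
  qed
  have nD: "real n \<le> D"
  proof -
    have "D / (8 * \<kappa>) \<le> D / 1" using \<kappa>1 D0 by (intro divide_left_mono) auto
    then show ?thesis using n(1) by simp
  qed
  have n\<gamma>: "D * l * u / 128 \<le> real n * \<gamma>"
  proof -
    have "D * l * u / 128 = D / (8 * \<kappa>) / 2 * (\<kappa> * (l * u / 8))" using \<kappa>1 by (simp add: field_simps)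
    also have "\<dots> \<le> real n * \<gamma>"
      using n(2) \<gamma>\<kappa> \<kappa>1 l1 u0 by (intro mult_mono) auto
    finally show ?thesis .
  qed
  define y where "y j = X j / D" for j
  have y0: "y j = 0 \<longleftrightarrow> X j = 0" for j using D0 by (simp add: y_def)
  \<comment> \<open>The largest exponent that keeps every \<open>s * y j\<close> at most 1, so that
    the exponential is bounded linearly in \<open>e\<close>.\<close>
  define s where "s = D / \<Lambda>"
  have sy: "s * y j = X j / \<Lambda>" for j using D0 by (simp add: s_def y_def)
  define B where "B = exp (2 * \<kappa> / \<Lambda>)"
  have Bw: "(\<Sum>i\<le>4 * b. w i * exp (s * y i)) \<le> B"
    if "\<And>i. 0 \<le> w i" "(\<Sum>i\<le>4 * b. w i) = 1" "(\<Sum>i\<le>4 * b. w i * X i) = \<kappa>" for w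
  proof -
    have e: "exp (s * y i) \<le> 1 + 2 / \<Lambda> * X i" for i
    proof -
      define x where "x = X i / \<Lambda>"
      have x: "0 \<le> x" "x \<le> 1" using X0[of i] \<Lambda>1 by (auto simp: x_def divide_le_eq)
      have "exp x \<le> 1 + x + x\<^sup>2" using x by (rule exp_bound)
      also have "\<dots> \<le> 1 + 2 * x" using x mult_left_mono[of x 1 x] by (simp add: power2_eq_square)
      finally show ?thesis unfolding sy x_def by simp
    qed
    have "(\<Sum>i\<le>4 * b. w i * exp (s * y i)) \<le> (\<Sum>i\<le>4 * b. w i * (1 + 2 / \<Lambda> * X i))"
      using that(1) e by (intro sum_mono mult_left_mono) auto
    also have "\<dots> = (\<Sum>i\<le>4 * b. w i) + 2 / \<Lambda> * (\<Sum>i\<le>4 * b. w i * X i)"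
      by (simp add: distrib_left sum.distrib sum_distrib_left mult_ac)
    also have "\<dots> = 1 + 2 * \<kappa> / \<Lambda>" using that by simp
    also have "\<dots> \<le> B" unfolding B_def by (rule exp_ge_add_one_self)
    finally show ?thesis .
  qed
  have B1: "1 \<le> B" unfolding B_def using \<kappa>1 \<Lambda>1 by simp
  \<comment> \<open>The moment factor costs at most s / 4 in the exponent, leaving -3 s / 8 + s / 4
    = - s / 8.\<close>
  have \<delta>: "exp (- 3 * s / 8) * B ^ n \<le> 1 / D ^ 3"
  proof -
    have "real n * (2 * \<kappa> / \<Lambda>) \<le> D / (8 * \<kappa>) * (2 * \<kappa> / \<Lambda>)"
      using n(1) \<kappa>1 \<Lambda>1 by (intro mult_right_mono) auto
    also have "\<dots> = s / 4" using \<kappa>1 by (simp add: s_def field_simps)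
    finally have "exp (- 3 * s / 8) * B ^ n \<le> exp (- 3 * s / 8) * exp (s / 4)"
      unfolding B_def exp_of_nat_mult[symmetric] by simp
    also have "\<dots> = exp (- (D / (8 * \<Lambda>)))" unfolding exp_add[symmetric] by (simp add: s_def field_simps)
    also have "\<dots> \<le> exp (- (3 * ln D))" using D\<Lambda> by simp
    also have "\<dots> = 1 / D ^ 3"
      using D0 exp_of_nat_mult[of 3 "ln D"] by (simp add: exp_minus inverse_eq_divide)
    finally show ?thesis .
  qed
  have main: "1 / 10000 * sqrt D * l \<le> real (nqueries A)"
    if A: "solves_support_est D \<epsilon> (Suc n) (Suc (Suc n)) A" for A
  proof (rule ccontr)
    define K where "K = 4 * nqueries A"
    define Z where "Z = 2 * \<Lambda> / D"
    assume "\<not> ?thesis"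
    then have K: "real K < 4 / 10000 * sqrt D * l" by (simp add: K_def)
    have KD: "real K \<le> D"
    proof -
      have "4 / 10000 * sqrt D * l \<le> sqrt D * sqrt D"
        using lD D(4) l1 D0 mult_mono[of "4 / 10000 * sqrt D" "sqrt D" l "sqrt D"] by simp
      then show ?thesis using K D0 by simp
    qed
    have Z0: "0 \<le> Z" using \<Lambda>1 D0 by (simp add: Z_def)
    \<comment> \<open>Here the constant 1/10000 is spent: the powers of \<open>l\<close> cancel
      between K^2 and \<Lambda>, and 32768 * 729 is below 10^8.\<close>
    have small: "(real K)\<^sup>2 * Z * exp 2 \<le> exp (- 4) * (real b)\<^sup>2"
    proof -
      have "(real K)\<^sup>2 \<le> (4 / 10000 * sqrt D * l)\<^sup>2" using K by (intro power_mono) auto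
      also have "\<dots> = 16 / 100000000 * D * l\<^sup>2" using D0 by (simp add: power_mult_distrib power_divide)
      finally have "(real K)\<^sup>2 * Z \<le> 16 / 100000000 * D * l\<^sup>2 * (2 * (1024 * (real b)\<^sup>2 / l\<^sup>2) / D)"
        unfolding Z_def using \<Lambda>le \<Lambda>1 D0
        by (intro mult_mono divide_right_mono) auto
      also have "\<dots> = 32768 / 100000000 * (real b)\<^sup>2" using D0 l1 by (simp add: field_simps)
      finally have KZ: "(real K)\<^sup>2 * Z \<le> 32768 / 100000000 * (real b)\<^sup>2" .
      have e6: "exp 2 * exp 4 \<le> (729 :: real)"
      proof -
        have "exp 2 * exp 4 = (exp 1 :: real) ^ 6" by (simp flip: exp_add exp_of_nat_mult)
        also have "\<dots> \<le> 3 ^ 6" by (intro power_mono exp_le) auto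
        finally show ?thesis by simp
      qed
      have "(real K)\<^sup>2 * Z * exp 2 * exp 4 = ((real K)\<^sup>2 * Z) * (exp 2 * exp 4)" by simp
      also have "\<dots> \<le> (32768 / 100000000 * (real b)\<^sup>2) * 729"
        by (rule mult_mono[OF KZ e6]) auto
      also have "\<dots> \<le> (real b)\<^sup>2" by simp
      finally have "(real K)\<^sup>2 * Z * exp 2 * exp 4 \<le> (real b)\<^sup>2" .
      then show ?thesis by (simp add: exp_minus field_simps)
    qed
    have tail: "(\<Sum>j\<in>{Suc b<..K}. (2 * real K) ^ (2 * j) * Z ^ j / fact (2 * j)) \<le> D * (1 / D ^ 4)"
    proof -
      have "exp (- 4 * real b) \<le> exp (- (4 * ln D))" using b(1) by simp
      also have "\<dots> = 1 / D ^ 4"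
        using D0 exp_of_nat_mult[of 4 "ln D"] by (simp add: exp_minus inverse_eq_divide)
      finally have eb: "exp (- 4 * real b) \<le> 1 / D ^ 4" .
      have "(\<Sum>j\<in>{Suc b<..K}. (2 * real K) ^ (2 * j) * Z ^ j / fact (2 * j))
          \<le> (\<Sum>j\<in>{Suc b<..K}. 1 / D ^ 4)"
        by (intro sum_mono order_trans[OF taylor_tail_bound[OF b0 Z0 small] eb]) auto
      also have "\<dots> \<le> D * (1 / D ^ 4)"
        using KD D0 by (simp only: sum_constant) (intro mult_right_mono, auto)
      finally show ?thesis .
    qed
    \<comment> \<open>One factor \<open>u\<close> is left over from \<epsilon> = u^2; it is at most
      1/1000, and thus \<open>2 * u\<close> is below \<open>l / 256\<close>.\<close>
    have gap: "2 * \<epsilon> * D < real n * \<gamma> / 2"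
    proof -
      have "2 * \<epsilon> * D = 2 * u * (D * u)" by (simp add: u2[symmetric] power2_eq_square)
      also have "\<dots> < l / 256 * (D * u)" using u1 l1 D0 u0 by (intro mult_strict_right_mono) auto
      also have "\<dots> = D * l * u / 128 / 2" by simp
      also have "\<dots> \<le> real n * \<gamma> / 2" by (rule divide_right_mono[OF n\<gamma>]) simp
      finally show ?thesis .
    qed
    have y_le: "y j \<le> 1 / 8" "2 * y j \<le> Z" for j
    proof -
      have "1 \<le> D / (8 * \<Lambda>)" using D\<Lambda> D(5) by linarith
      then have "\<Lambda> / D \<le> 1 / 8" using D0 \<Lambda>1 by (simp add: le_divide_eq divide_le_eq)
      then show "y j \<le> 1 / 8" "2 * y j \<le> Z"
        using X0(2)[of j] D0 divide_right_mono[of "X j" \<Lambda> D] by (auto simp: y_def Z_def)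
    qed
    have "1 / 3 \<le> real n * (2 * real (2 * K + 1) *
        (\<Sum>j\<in>{Suc b<..K}. (2 * real K) ^ (2 * j) * Z ^ j / fact (2 * j)))
      + (2 * real n + 1) * (exp (- 3 * s / 8) * B ^ n) + exp (- real n * \<gamma> / 12)"
      unfolding K_def
    proof (rule separation_bound[OF A, where I = "{..4 * b}" and y = y and ?w0.0 = w0 and ?w1.0 = w1])
      show "y j = 0 \<or> 1 / D \<le> y j" for j using X[of j] D0 by (auto simp: y_def divide_right_mono)
      show "(\<Sum>j\<le>4 * b. (w1 j - w0 j) * y j ^ q) = 0" if "q \<le> Suc b" for q
        using mom[OF that] by (simp add: y_def power_divide flip: sum_divide_distrib)
      show "0 \<le> s" using D0 \<Lambda>1 by (simp add: s_def)
    qed (use D y_le Z0 w sums w10 y0 \<gamma> B1 Bw[OF w(1) sums(1) \<kappa>0] Bw[OF w(2) sums(2) \<kappa>] gap in auto)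
    also have "\<dots> \<le> D * (2 * (3 * D) * (D * (1 / D ^ 4))) + 3 * D * (1 / D ^ 3) + 1 / 10"
    proof (intro add_mono mult_mono nD tail \<delta>)
      show "real (2 * K + 1) \<le> 3 * D" using KD D by simp
      show "2 * real n + 1 \<le> 3 * D" using nD D by simp
      \<comment> \<open>The lower bound on \<open>sqrt D\<close> gives n \<gamma> at least 108, so
        the Chernoff exponent is at least 9.\<close>
      have "13824 / 128 \<le> sqrt D / 128" using D(3) by simp
      also have "\<dots> = D * (1 / sqrt D) / 128" using D0 by (simp add: real_div_sqrt)
      also have "\<dots> \<le> D * (l * u) / 128"
      proof (intro divide_right_mono mult_left_mono)
        have "u \<le> l * u" using l1 u0 by simp
        with uD show "1 / sqrt D \<le> l * u" by (rule order_trans)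
      qed (use D0 in auto)
      also have "\<dots> = D * l * u / 128" by simp
      also have "\<dots> \<le> real n * \<gamma>" by (rule n\<gamma>)
      finally have "9 \<le> real n * \<gamma> / 12" by simp
      then have "10 \<le> exp (real n * \<gamma> / 12)" using exp_ge_add_one_self[of "real n * \<gamma> / 12"] by linarith
      then show "exp (- real n * \<gamma> / 12) \<le> 1 / 10" by (simp add: exp_minus field_simps)
    qed (use D0 B1 Z0 in \<open>auto intro!: mult_nonneg_nonneg sum_nonneg divide_nonneg_nonneg\<close>)
    also have "\<dots> = 6 / D + 3 / D\<^sup>2 + 1 / 10"
      using D0 by (simp add: power2_eq_square power3_eq_cube power4_eq_xxxx)
    also have "\<dots> \<le> 6 / 1000 + 3 / 1000\<^sup>2 + 1 / 10"
      using D by (intro add_mono divide_left_mono power_mono) auto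
    finally show False by simp
  qed
  then show ?thesis unfolding l_def by blast
qed

theorem theorem2p16:
  shows "\<exists>c>0. \<exists>\<epsilon>0>0. \<exists>d0::nat. \<forall>d::nat. \<forall>\<epsilon>::real.
           d \<ge> d0 \<longrightarrow> 1 / real d \<le> \<epsilon> \<longrightarrow> \<epsilon> \<le> \<epsilon>0 \<longrightarrow>
           (\<exists>n m. \<forall>A. solves_support_est (real d) \<epsilon> n m A \<longrightarrow>
              real (nqueries A) \<ge> c * sqrt (real d) / sqrt (ln (real d)) * ln (1 / \<epsilon>))"
proof -
  have "\<forall>\<^sub>F d :: nat in at_top. 98304 * ln (real d) ^ 3 \<le> real d"
    "\<forall>\<^sub>F d :: nat in at_top. 13824 \<le> sqrt (real d)"
    "\<forall>\<^sub>F d :: nat in at_top. ln (real d) \<le> sqrt (real d)"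
    "\<forall>\<^sub>F d :: nat in at_top. 1 \<le> ln (real d)"
    by real_asymp+
  with eventually_ge_at_top[of "1000 :: nat"]
  have "\<forall>\<^sub>F d :: nat in at_top. 1000 \<le> d \<and> 98304 * ln (real d) ^ 3 \<le> real d \<and>
      13824 \<le> sqrt (real d) \<and> ln (real d) \<le> sqrt (real d) \<and> 1 \<le> ln (real d)"
    by eventually_elim auto
  then obtain d0 where d0: "\<And>d. d0 \<le> d \<Longrightarrow> 1000 \<le> d \<and> 98304 * ln (real d) ^ 3 \<le> real d \<and>
      13824 \<le> sqrt (real d) \<and> ln (real d) \<le> sqrt (real d) \<and> 1 \<le> ln (real d)"
    unfolding eventually_at_top_linorder by blast
  have "\<exists>n m. \<forall>A. solves_support_est (real d) \<epsilon> n m A \<longrightarrow>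
      real (nqueries A) \<ge> 1 / 10000 * sqrt (real d) / sqrt (ln (real d)) * ln (1 / \<epsilon>)"
    if d: "d0 \<le> d" and \<epsilon>: "1 / real d \<le> \<epsilon>" "\<epsilon> \<le> 1 / 1000000" for d \<epsilon>
  proof -
    note large = d0[OF d]
    obtain n where n: "\<And>A. solves_support_est (real d) \<epsilon> (Suc n) (Suc (Suc n)) A \<Longrightarrow>
        1 / 10000 * sqrt (real d) * ln (1 / \<epsilon>) \<le> real (nqueries A)"
      using query_lower_bound[of "real d" \<epsilon>] large \<epsilon> by auto
    have "0 < \<epsilon>" using large by (intro less_le_trans[OF _ \<epsilon>(1)]) simp
    then have "0 \<le> ln (1 / \<epsilon>)" using \<epsilon>(2) by (intro ln_ge_zero) (simp add: le_divide_eq)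
    \<comment> \<open>As ln d is at least 1, dividing by its square root only lowers the
      bound.\<close>
    moreover have "1 / 10000 * sqrt (real d) / sqrt (ln (real d)) \<le> 1 / 10000 * sqrt (real d) / 1"
      using large by (intro divide_left_mono) auto
    ultimately have le: "1 / 10000 * sqrt (real d) / sqrt (ln (real d)) * ln (1 / \<epsilon>)
        \<le> 1 / 10000 * sqrt (real d) * ln (1 / \<epsilon>)"
      by (intro mult_right_mono) auto
    \<comment> \<open>Register A holds the \<open>n\<close> drawn outcomes and outcome 0; register B
      has one more dimension for the shift in the oracle.\<close>
    show ?thesis
      by (rule exI[of _ "Suc n"], rule exI[of _ "Suc (Suc n)"]) (intro allI impI order_trans[OF le n])
  qed
  then show ?thesis
    by - (rule exI[of _ "1 / 10000"], rule conjI, simp, rule exI[of _ "1 / 1000000"],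
        rule conjI, simp, rule exI[of _ d0], blast)
qed

end
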